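(* Let $\lambda\in\mathbb{D}\setminus\{0\}$ be fixed. There is a constant $c(\lambda)>0$, depending only on $\lambda$, such that for every $n\ge1$ $$\mathcal{S}(n)\;\ge\;\phi(\underbrace{\lambda,\dots,\lambda}_{n})\;\ge\; c(\lambda)\sqrt{n}.$$
   Context: $\mathbb{D}$ is the open unit disk. $\mathcal{S}(n)$ denotes the smallest constant $\mathcal{S}$ such that $|\det T|\,\|T^{-1}\|\le \mathcal{S}\,\|T\|^{n-1}$ holds for every invertible complex $n\times n$ matrix $T$ and every operator norm $\|\cdot\|$ induced by a norm on $\mathbb{C}^n$. The Wiener algebra is $W=\{f=\sum_{k\ge0}\hat f(k)z^k : \|f\|_W:=\sum_{k\ge0}|\hat f(k)|<\infty\}$, a space of holomorphic functions on $\mathbb{D}$. For $(\lambda_1,\dots,\lambda_n)\in\mathbb{D}^n$, $$\phi(\lambda_1,\dots,\lambda_n):=\inf\Big\{\|h\|_W-|h(0)| \;:\; h\in W,\ h(0)=\prod_{i=1}^n\lambda_i,\ h(\lambda_i)=0,\ i=1,\dots,n\Big\},$$ where the zeros are counted with multiplicity (a value occurring $k$ times among the $\lambda_i$ must be a zero of $h$ of order at least $k$). *)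

theory Defs
  imports "HOL-Analysis.FPS_Convergence" "Jordan_Normal_Form.Determinant"
begin

definition is_norm_on :: "nat \<Rightarrow> (complex vec \<Rightarrow> real) \<Rightarrow> bool" where
  "is_norm_on n N \<longleftrightarrow>
     (\<forall>v \<in> carrier_vec n. 0 \<le> N v \<and> (N v = 0 \<longleftrightarrow> v = 0\<^sub>v n)) \<and>
     (\<forall>a. \<forall>v \<in> carrier_vec n. N (a \<cdot>\<^sub>v v) = cmod a * N v) \<and>
     (\<forall>u \<in> carrier_vec n. \<forall>v \<in> carrier_vec n. N (u + v) \<le> N u + N v)"

definition induced_norm :: "nat \<Rightarrow> (complex vec \<Rightarrow> real) \<Rightarrow> complex mat \<Rightarrow> real" where
  "induced_norm n N A = Sup {N (A *\<^sub>v v) | v. v \<in> carrier_vec n \<and> N v \<le> 1}"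

definition schaeffer_bound :: "nat \<Rightarrow> real \<Rightarrow> bool" where
  "schaeffer_bound n s \<longleftrightarrow>
     (\<forall>N T R. is_norm_on n N \<and> T \<in> carrier_mat n n \<and> R \<in> carrier_mat n n \<and>
        inverts_mat T R \<and> inverts_mat R T \<longrightarrow>
        cmod (Determinant.det T) * induced_norm n N R \<le> s * induced_norm n N T ^ (n - 1))"

text \<open>For \<open>n \<ge> 1\<close> the set of admissible constants is a nonempty closed subset of the
  nonnegative reals, so that the infimum is the smallest admissible constant.\<close>

definition schaeffer_const :: "nat \<Rightarrow> real" where
  "schaeffer_const n = Inf {s. schaeffer_bound n s}"

text \<open>An element of the Wiener algebra is represented by its power series; the corresponding
  holomorphic function on the unit disk is \<open>eval_fps h\<close>.\<close>

definition wiener :: "complex fps set" where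
  "wiener = {h. summable (\<lambda>k. cmod (fps_nth h k))}"

definition wiener_norm :: "complex fps \<Rightarrow> real" where
  "wiener_norm h = (\<Sum>k. cmod (fps_nth h k))"

definition zero_of_order_ge :: "(complex \<Rightarrow> complex) \<Rightarrow> complex \<Rightarrow> nat \<Rightarrow> bool" where
  "zero_of_order_ge f z k \<longleftrightarrow> (\<forall>j<k. (deriv ^^ j) f z = 0)"

definition wiener_phi :: "complex list \<Rightarrow> real" where
  "wiener_phi ls = Inf {wiener_norm h - cmod (eval_fps h 0) | h.
     h \<in> wiener \<and> eval_fps h 0 = prod_list ls \<and>
     (\<forall>l \<in> set ls. zero_of_order_ge (eval_fps h) l (count_list ls l))}"

end

theory Submission
  imports Defs "HOL-Complex_Analysis.Cauchy_Integral_Formula"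
    "Jordan_Normal_Form.Schur_Decomposition"
begin

text \<open>
  Both inequalities come from the ideal of all \<open>h\<close> in the Wiener algebra that vanish at \<open>l\<close> to
  order \<open>n\<close>.

  For \<open>schaeffer_const n \<ge> wiener_phi\<close>, the space \<open>\<complex>\<^sup>n\<close> is identified with the quotient of the
  Wiener algebra by this ideal through the first \<open>n\<close> Taylor coefficients at \<open>l\<close>, and it is given
  the quotient norm. Multiplication by \<open>z\<close> is a contraction \<open>T\<close> of the quotient with determinant
  \<open>l ^ n\<close>. The representatives \<open>g\<close> of \<open>det T \<cdot> T\<^sup>-\<^sup>1 [1]\<close> are exactly those for which
  \<open>h = l ^ n - z g\<close> lies in the ideal, and then \<open>\<parallel>h\<parallel> - \<bar>h(0)\<bar> = \<parallel>g\<parallel>\<close>. So the norm of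
  \<open>det T \<cdot> T\<^sup>-\<^sup>1 [1]\<close> is at least the infimum \<open>wiener_phi\<close>
  (lemma \<open>wiener_phi_le_schaeffer_bound\<close>).
  The constant \<open>schaeffer_const n\<close> is an infimum of reals, so it also has to be shown that some
  admissible constant exists; \<open>2 ^ n\<close> is one, by the Cayley-Hamilton theorem
  (lemma \<open>schaeffer_bound_exists\<close>).

  For \<open>wiener_phi \<ge> c \<cdot> sqrt n\<close>, let \<open>h\<close> be admissible. After a rotation \<open>l = r > 0\<close>.
  Write \<open>h = (z - r) ^ n g\<close>, so that \<open>\<bar>g(0)\<bar> = 1\<close> because \<open>h(0) = r ^ n\<close>, and let
  \<open>b = (z - r) / (1 - r z)\<close>. On the unit circle \<open>b\<close> is unimodular, hence
  \<open>h \<cdot> cnj b ^ n \<cdot> (1 - z\<^sup>2) = g \<cdot> (1 - r z) ^ n \<cdot> (1 - z\<^sup>2)\<close> has mean value \<open>g(0)\<close> there.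
  Expanding \<open>h\<close> bounds the same mean value by \<open>\<parallel>h\<parallel>\<close> times the largest modulus of a Fourier
  coefficient of \<open>cnj b ^ n \<cdot> (1 - z\<^sup>2)\<close>. The phase of \<open>b ^ n\<close> has two inflection points, at
  \<open>z = 1\<close> and \<open>z = -1\<close>, and because of them the coefficients of \<open>b ^ n\<close> itself have size only
  \<open>n powr (- 1 / 3)\<close>. The factor \<open>1 - z\<^sup>2\<close> vanishes at these two points and is there comparable
  to the second derivative of the phase, which improves the decay to \<open>1 / sqrt n\<close>
  (lemma \<open>blaschke_wave_integral_bound\<close>). Hence \<open>\<parallel>h\<parallel> \<ge> c \<cdot> sqrt n\<close>, and the zero of \<open>h\<close> at \<open>l\<close>
  forces \<open>\<bar>h(0)\<bar> \<le> \<parallel>h\<parallel> / 2\<close>.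
\<close>

text \<open>
  The notation for vectors, matrices and determinants refers to those with explicit carriers
  throughout, since their size \<open>n\<close> is a variable.
\<close>
unbundle no vec_syntax
hide_const (open) Finite_Cartesian_Product.vec Finite_Cartesian_Product.mat Determinants.det
    Finite_Cartesian_Product.row

section \<open>The Wiener algebra\<close>

lemma wiener_summable: "h \<in> wiener \<Longrightarrow> summable (\<lambda>k. cmod (fps_nth h k))"
  by (simp add: wiener_def)


lemma wiener_norm_nonneg: "h \<in> wiener \<Longrightarrow> 0 \<le> wiener_norm h"
  unfolding wiener_norm_def by (intro suminf_nonneg wiener_summable) auto

lemma wiener_0: "0 \<in> wiener" "wiener_norm 0 = 0"
  by (simp_all add: wiener_def wiener_norm_def)

text \<open>
  This additivity is why \<open>\<parallel>h\<parallel> - \<bar>h(0)\<bar>\<close> is the norm of \<open>(h - h(0)) / z\<close>: in the extremal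
  problem, subtracting \<open>\<bar>h(0)\<bar>\<close> turns an infimum over \<open>h\<close> into a quotient norm.
\<close>
lemma wiener_const_mult_X_add:
  assumes "g \<in> wiener"
  shows "fps_const c + fps_X * g \<in> wiener"
    and "wiener_norm (fps_const c + fps_X * g) = cmod c + wiener_norm g"
proof -
  have nth: "cmod (fps_nth (fps_const c + fps_X * g) (Suc k)) = cmod (fps_nth g k)" for k
    by simp
  have "(\<lambda>k. cmod (fps_nth (fps_const c + fps_X * g) (Suc k))) sums wiener_norm g"
    unfolding nth wiener_norm_def by (intro summable_sums wiener_summable assms)
  then have "(\<lambda>k. cmod (fps_nth (fps_const c + fps_X * g) k)) sums (wiener_norm g + cmod c)"
    by (subst (asm) sums_Suc_iff) simp
  then show "fps_const c + fps_X * g \<in> wiener"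
    and "wiener_norm (fps_const c + fps_X * g) = cmod c + wiener_norm g"
    by (auto simp: wiener_def wiener_norm_def sums_iff)
qed

lemma wiener_X_mult:
  assumes "g \<in> wiener"
  shows "fps_X * g \<in> wiener" "wiener_norm (fps_X * g) = wiener_norm g"
  using wiener_const_mult_X_add[OF assms, of 0] by auto

lemma wiener_const: "fps_const c \<in> wiener" "wiener_norm (fps_const c) = cmod c"
  using wiener_const_mult_X_add[OF wiener_0(1), of c] by (auto simp: wiener_0)

lemma wiener_add:
  assumes "f \<in> wiener" "g \<in> wiener"
  shows "f + g \<in> wiener" "wiener_norm (f + g) \<le> wiener_norm f + wiener_norm g"
proof -
  have s: "summable (\<lambda>k. cmod (fps_nth f k) + cmod (fps_nth g k))"
    by (intro summable_add wiener_summable assms)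
  show *: "f + g \<in> wiener" unfolding wiener_def mem_Collect_eq
    by (rule summable_comparison_test'[OF s, of 0]) (simp add: norm_triangle_ineq)
  have "wiener_norm (f + g) \<le> (\<Sum>k. cmod (fps_nth f k) + cmod (fps_nth g k))"
    unfolding wiener_norm_def
    by (intro suminf_le s wiener_summable *) (simp add: norm_triangle_ineq)
  then show "wiener_norm (f + g) \<le> wiener_norm f + wiener_norm g"
    unfolding wiener_norm_def by (simp add: suminf_add wiener_summable assms)
qed

lemma wiener_mult:
  assumes "f \<in> wiener" "g \<in> wiener"
  shows "f * g \<in> wiener"
proof -
  have s: "summable (\<lambda>k. \<Sum>i\<le>k. cmod (fps_nth f i) * cmod (fps_nth g (k - i)))"
    by (intro summable_Cauchy_product) (use assms in \<open>auto simp: wiener_def\<close>)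
  show ?thesis unfolding wiener_def mem_Collect_eq
    by (rule summable_comparison_test'[OF s, of 0])
       (auto simp: fps_mult_nth norm_mult atLeast0AtMost intro!: order_trans[OF norm_sum])
qed

lemma wiener_const_mult:
  assumes "h \<in> wiener"
  shows "wiener_norm (fps_const c * h) = cmod c * wiener_norm h"
  unfolding wiener_norm_def by (simp add: norm_mult suminf_mult wiener_summable assms)

lemma wiener_power: "f \<in> wiener \<Longrightarrow> f ^ n \<in> wiener"
  by (induction n) (use wiener_const(1)[of 1] in \<open>auto intro: wiener_mult\<close>)

lemma wiener_X: "fps_X \<in> wiener"
  using wiener_X_mult(1)[OF wiener_const(1)[of 1]] by simp

lemma wiener_diff: "f \<in> wiener \<Longrightarrow> g \<in> wiener \<Longrightarrow> f - g \<in> wiener"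
  using wiener_add(1)[of f "fps_const (-1) * g"] wiener_mult[OF wiener_const(1), of g "-1"]
  by (simp add: fps_const_neg[symmetric] del: fps_const_neg)

lemma wiener_eval_summable:
  assumes "h \<in> wiener" "cmod z \<le> 1"
  shows "summable (\<lambda>k. cmod (fps_nth h k * z ^ k))"
  by (rule summable_comparison_test'[OF wiener_summable[OF assms(1)], of 0])
     (use assms(2) in \<open>auto simp: norm_mult norm_power intro!: mult_left_le power_le_one\<close>)

lemma wiener_eval_mult:
  assumes "f \<in> wiener" "g \<in> wiener" "cmod z \<le> 1"
  shows "eval_fps (f * g) z = eval_fps f z * eval_fps g z"
proof -
  have "eval_fps f z * eval_fps g z =
          (\<Sum>k. \<Sum>i\<le>k. (fps_nth f i * z ^ i) * (fps_nth g (k - i) * z ^ (k - i)))"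
    unfolding eval_fps_def by (intro Cauchy_product wiener_eval_summable assms)
  also have "\<dots> = (\<Sum>k. fps_nth (f * g) k * z ^ k)"
    by (auto intro!: suminf_cong sum.cong
        simp: fps_mult_nth atLeast0AtMost sum_distrib_left power_add[symmetric] algebra_simps)
  finally show ?thesis by (simp add: eval_fps_def)
qed

lemma wiener_eval_power:
  "f \<in> wiener \<Longrightarrow> cmod z \<le> 1 \<Longrightarrow> eval_fps (f ^ n) z = eval_fps f z ^ n"
  by (induction n) (auto simp: wiener_eval_mult wiener_power)

lemma wiener_eval_diff:
  assumes "f \<in> wiener" "g \<in> wiener" "cmod z \<le> 1"
  shows "eval_fps (f - g) z = eval_fps f z - eval_fps g z"
proof -
  have "(\<lambda>k. fps_nth f k * z ^ k - fps_nth g k * z ^ k) sums (eval_fps f z - eval_fps g z)"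
    unfolding eval_fps_def
    by (intro sums_diff summable_sums summable_norm_cancel[OF wiener_eval_summable] assms)
  then show ?thesis by (simp add: eval_fps_def sums_iff algebra_simps)
qed

lemma wiener_eval_bound:
  assumes "h \<in> wiener" "cmod z \<le> 1"
  shows "cmod (eval_fps h z) \<le> wiener_norm h"
proof -
  have "cmod (eval_fps h z) \<le> (\<Sum>k. cmod (fps_nth h k * z ^ k))"
    unfolding eval_fps_def by (intro summable_norm wiener_eval_summable assms)
  also have "\<dots> \<le> wiener_norm h"
    unfolding wiener_norm_def
    by (intro suminf_le wiener_eval_summable assms wiener_summable)
       (use assms(2) in \<open>auto simp: norm_mult norm_power intro!: mult_left_le power_le_one\<close>)
  finally show ?thesis .
qed

lemma wiener_conv_radius:
  assumes "h \<in> wiener"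
  shows "fps_conv_radius h \<ge> 1"
proof -
  have "summable (\<lambda>k. fps_nth h k * 1 ^ k)"
    using summable_norm_cancel[OF wiener_summable[OF assms]] by simp
  then show ?thesis unfolding fps_conv_radius_def
    using conv_radius_geI[of "fps_nth h" 1] by (simp add: one_ereal_def)
qed

text \<open>
  The quotient has the tail sums \<open>g\<^sub>k = (\<Sum>j. h\<^sub>k\<^sub>+\<^sub>1\<^sub>+\<^sub>j l ^ j)\<close> as coefficients. They satisfy
  \<open>g\<^sub>k = h\<^sub>k\<^sub>+\<^sub>1 + l g\<^sub>k\<^sub>+\<^sub>1\<close>; taking moduli and summing over \<open>k\<close> gives
  \<open>(1 - \<bar>l\<bar>) \<parallel>g\<parallel> \<le> \<parallel>h\<parallel>\<close>, so division does not leave the algebra.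
\<close>
lemma wiener_division:
  assumes h: "h \<in> wiener" and l: "cmod l < 1" and zero: "eval_fps h l = 0"
  obtains g where "g \<in> wiener" "h = (fps_X - fps_const l) * g"
proof -
  define a where "a = (\<lambda>k j. fps_nth h (Suc k + j) * l ^ j)"
  define g where "g = Abs_fps (\<lambda>k. \<Sum>j. a k j)"
  have sh: "summable (\<lambda>j. cmod (fps_nth h (k + j)))" for k
    using wiener_summable[OF h] summable_iff_shift[of "\<lambda>j. cmod (fps_nth h j)" k]
    by (simp add: add.commute)
  have sa: "summable (\<lambda>j. cmod (a k j))" for k
    by (rule summable_comparison_test'[OF sh[of "Suc k"], of 0])
       (use l in \<open>auto simp: a_def norm_mult norm_power intro!: mult_left_le power_le_one\<close>)
  have g_nth: "fps_nth g k = (\<Sum>j. a k j)" for k by (simp add: g_def)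
  have rec: "fps_nth h (Suc k) = fps_nth g k - l * fps_nth g (Suc k)" for k
  proof -
    have "(\<Sum>j. a k j) = a k 0 + (\<Sum>j. a k (Suc j))"
      using suminf_split_head[OF summable_norm_cancel[OF sa[of k]]] by simp
    also have "(\<Sum>j. a k (Suc j)) = (\<Sum>j. l * a (Suc k) j)"
      by (simp add: a_def algebra_simps)
    also have "\<dots> = l * (\<Sum>j. a (Suc k) j)"
      by (rule suminf_mult[OF summable_norm_cancel[OF sa]])
    finally show ?thesis by (simp add: g_nth a_def)
  qed
  have rec0: "fps_nth h 0 = - l * fps_nth g 0"
  proof -
    have "0 = fps_nth h 0 + (\<Sum>j. fps_nth h (Suc j) * l ^ Suc j)"
      using zero suminf_split_head[OF summable_norm_cancel[OF wiener_eval_summable[OF h, of l]]] l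
      by (simp add: eval_fps_def)
    also have "(\<Sum>j. fps_nth h (Suc j) * l ^ Suc j) = l * (\<Sum>j. a 0 j)"
      by (subst suminf_mult[OF summable_norm_cancel[OF sa], symmetric])
         (simp add: a_def algebra_simps)
    finally show ?thesis by (simp add: g_nth add_eq_0_iff)
  qed
  have eq: "h = (fps_X - fps_const l) * g"
  proof (rule fps_ext)
    fix k show "fps_nth h k = fps_nth ((fps_X - fps_const l) * g) k"
      using rec rec0 by (cases k) (auto simp: left_diff_distrib)
  qed
  have "g \<in> wiener"
  proof -
    have bound: "(\<Sum>k<m. cmod (fps_nth g k)) * (1 - cmod l) \<le> wiener_norm h" for m
    proof -
      have *: "cmod (fps_nth g k) \<le> cmod (fps_nth h (Suc k)) + cmod l * cmod (fps_nth g (Suc k))"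
          for k
        using norm_triangle_ineq[of "fps_nth h (Suc k)" "l * fps_nth g (Suc k)"]
        by (simp add: rec norm_mult)
      have gb: "cmod (fps_nth g k) \<le> (\<Sum>j. cmod (fps_nth h (Suc k + j)))" for k
      proof -
        have "cmod (fps_nth g k) \<le> (\<Sum>j. cmod (a k j))"
          unfolding g_nth by (rule summable_norm[OF sa])
        also have "\<dots> \<le> (\<Sum>j. cmod (fps_nth h (Suc k + j)))"
          by (intro suminf_le sa sh)
             (use l in \<open>auto simp: a_def norm_mult norm_power intro!: mult_left_le power_le_one\<close>)
        finally show ?thesis .
      qed
      have "(\<Sum>k<m. cmod (fps_nth g k)) \<le>
              (\<Sum>k<m. cmod (fps_nth h (Suc k))) + cmod l * (\<Sum>k<m. cmod (fps_nth g (Suc k)))"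
        unfolding sum_distrib_left sum.distrib[symmetric] by (intro sum_mono *)
      also have "(\<Sum>k<m. cmod (fps_nth g (Suc k))) =
                 (\<Sum>k<m. cmod (fps_nth g k)) + cmod (fps_nth g m) - cmod (fps_nth g 0)"
        by (induction m) auto
      also have "cmod l * \<dots> \<le> cmod l * (\<Sum>k<m. cmod (fps_nth g k)) + cmod (fps_nth g m)"
      proof -
        have "cmod l * (cmod (fps_nth g m) - cmod (fps_nth g 0)) \<le> cmod (fps_nth g m)"
        proof -
          have "cmod l * cmod (fps_nth g m) \<le> cmod (fps_nth g m)"
            using l by (intro mult_left_le_one_le) auto
          moreover have "0 \<le> cmod l * cmod (fps_nth g 0)" by simp
          ultimately show ?thesis unfolding right_diff_distrib by linarith
        qed
        then show ?thesis by (simp add: algebra_simps)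
      qed
      also have "cmod (fps_nth g m) \<le> (\<Sum>j. cmod (fps_nth h (Suc m + j)))" by (rule gb)
      finally have "(\<Sum>k<m. cmod (fps_nth g k)) * (1 - cmod l) \<le>
             (\<Sum>k<m. cmod (fps_nth h (Suc k))) + (\<Sum>j. cmod (fps_nth h (Suc m + j)))"
        by (simp add: algebra_simps)
      also have "\<dots> \<le> (\<Sum>k<Suc m. cmod (fps_nth h k)) + (\<Sum>j. cmod (fps_nth h (Suc m + j)))"
        by (simp only: sum.lessThan_Suc_shift) simp
      also have "\<dots> = wiener_norm h"
        unfolding wiener_norm_def
        by (subst suminf_split_initial_segment[OF wiener_summable[OF h], of "Suc m"])
           (simp add: add.commute)
      finally show ?thesis .
    qed
    show ?thesis unfolding wiener_def mem_Collect_eq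
    proof (rule bounded_imp_summable[where B = "wiener_norm h / (1 - cmod l)"])
      fix m show "(\<Sum>k\<le>m. cmod (fps_nth g k)) \<le> wiener_norm h / (1 - cmod l)"
        using bound[of "Suc m"] l by (simp add: lessThan_Suc_atMost pos_le_divide_eq)
    qed auto
  qed
  with eq show ?thesis using that by blast
qed

section \<open>Taylor coefficients and zeros of high order\<close>

definition taylor_coeff :: "complex \<Rightarrow> nat \<Rightarrow> complex fps \<Rightarrow> complex" where
  "taylor_coeff l j h = eval_fps ((fps_deriv ^^ j) h) l / fact j"

lemma conv_radius_deriv_pow:
  assumes "h \<in> wiener" shows "fps_conv_radius ((fps_deriv ^^ j) h) \<ge> 1"
proof (induction j)
  case (Suc j)
  then show ?case using fps_conv_radius_deriv[of "(fps_deriv ^^ j) h"] by simp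
qed (simp add: wiener_conv_radius assms)

lemma less_conv_radius_deriv_pow:
  assumes "h \<in> wiener" "cmod l < 1" shows "ereal (cmod l) < fps_conv_radius ((fps_deriv ^^ j) h)"
  using conv_radius_deriv_pow[OF assms(1), of j] assms(2)
  by (metis less_ereal.simps(1) one_ereal_def order_less_le_trans)

lemma higher_deriv_eval_fps:
  assumes "h \<in> wiener" "cmod l < 1"
  shows "(deriv ^^ j) (eval_fps h) l = eval_fps ((fps_deriv ^^ j) h) l"
  using assms(2)
proof (induction j arbitrary: l)
  case (Suc j)
  have "(deriv ^^ Suc j) (eval_fps h) l = deriv ((deriv ^^ j) (eval_fps h)) l" by simp
  also have "\<dots> = deriv (eval_fps ((fps_deriv ^^ j) h)) l"
  proof (rule deriv_cong_ev)
    have "\<forall>\<^sub>F z in nhds l. z \<in> ball 0 1"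
      using Suc.prems by (intro eventually_nhds_in_open) auto
    then show "\<forall>\<^sub>F z in nhds l. (deriv ^^ j) (eval_fps h) z = eval_fps ((fps_deriv ^^ j) h) z"
      by eventually_elim (use Suc.IH in auto)
  qed simp
  also have "\<dots> = eval_fps (fps_deriv ((fps_deriv ^^ j) h)) l"
    by (rule eval_fps_deriv[symmetric]) (rule less_conv_radius_deriv_pow[OF assms(1) Suc.prems])
  finally show ?case by simp
qed simp

lemma taylor_coeff_deriv:
  "h \<in> wiener \<Longrightarrow> cmod l < 1 \<Longrightarrow> taylor_coeff l j h = (deriv ^^ j) (eval_fps h) l / fact j"
  by (simp add: taylor_coeff_def higher_deriv_eval_fps)

lemma zero_of_order_ge_iff:
  assumes "h \<in> wiener" "cmod l < 1"
  shows "zero_of_order_ge (eval_fps h) l n \<longleftrightarrow> (\<forall>j<n. taylor_coeff l j h = 0)"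
  by (simp add: zero_of_order_ge_def taylor_coeff_deriv[OF assms])

lemma fps_deriv_pow_add: "(fps_deriv ^^ j) (f + g)
    = (fps_deriv ^^ j) f + (fps_deriv ^^ j) (g :: complex fps)"
  by (induction j) auto

lemma fps_deriv_pow_cmult:
    "(fps_deriv ^^ j) (fps_const c * f) = fps_const c * (fps_deriv ^^ j) (f :: complex fps)"
  by (induction j) auto

lemma taylor_coeff_add:
  assumes "f \<in> wiener" "g \<in> wiener" "cmod l < 1"
  shows "taylor_coeff l j (f + g) = taylor_coeff l j f + taylor_coeff l j g"
  by (simp add: taylor_coeff_def fps_deriv_pow_add eval_fps_add less_conv_radius_deriv_pow assms
      add_divide_distrib)

lemma taylor_coeff_cmult:
  assumes "f \<in> wiener" "cmod l < 1"
  shows "taylor_coeff l j (fps_const c * f) = c * taylor_coeff l j f"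
proof -
  have "eval_fps (fps_const c * g) z = c * eval_fps g z"
      if "ereal (cmod z) < fps_conv_radius g" for g z
    using that by (subst eval_fps_mult) auto
  then show ?thesis
    by (simp add: taylor_coeff_def fps_deriv_pow_cmult less_conv_radius_deriv_pow assms)
qed

lemma fps_deriv_pow_linear_mult:
  fixes f :: "complex fps"
  shows "(fps_deriv ^^ Suc j) ((fps_X - fps_const l) * f) =
    (fps_X - fps_const l) * (fps_deriv ^^ Suc j) f + of_nat (Suc j) * (fps_deriv ^^ j) f"
proof (induction j)
  case (Suc j)
  have "(fps_deriv ^^ Suc (Suc j)) ((fps_X - fps_const l) * f) =
      fps_deriv ((fps_deriv ^^ Suc j) ((fps_X - fps_const l) * f))" by simp
  also have "\<dots> = (fps_X - fps_const l) * (fps_deriv ^^ Suc (Suc j)) f +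
      of_nat (Suc (Suc j)) * (fps_deriv ^^ Suc j) f"
  proof -
    have "fps_deriv (of_nat k * f) = of_nat k * fps_deriv f" for k and f :: "complex fps"
      by (simp add: fps_of_nat[symmetric])
    then show ?thesis unfolding Suc by (simp add: algebra_simps)
  qed
  finally show ?case .
qed (simp add: algebra_simps)

text \<open>
  In Taylor coordinates at \<open>l\<close>, multiplication by \<open>z - l\<close> is the nilpotent shift. Everything below
  about the ideal of functions vanishing to order \<open>n\<close> rests on this: multiplication by \<open>z\<close> becomes
  a Jordan block, the coordinates are onto, and zeros can be split off one at a time.
\<close>
lemma taylor_coeff_linear_mult:
  assumes f: "f \<in> wiener" and l: "cmod l < 1"
  shows "taylor_coeff l j ((fps_X - fps_const l) * f)
      = (if j = 0 then 0 else taylor_coeff l (j - 1) f)"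
proof (cases j)
  case 0
  have "eval_fps ((fps_X - fps_const l) * f) l = 0"
    by (subst wiener_eval_mult)
       (use f l wiener_eval_diff[of fps_X "fps_const l" l] in
           \<open>auto intro: wiener_diff wiener_X wiener_const\<close>)
  with 0 show ?thesis by (simp add: taylor_coeff_def)
next
  case (Suc i)
  have r: "ereal (cmod l) < fps_conv_radius ((fps_deriv ^^ i) f)"
     "ereal (cmod l) < fps_conv_radius ((fps_deriv ^^ Suc i) f)"
    by (rule less_conv_radius_deriv_pow[OF f l])+
  have rX: "fps_conv_radius (fps_X - fps_const l) = \<infinity>"
    using fps_conv_radius_diff[of fps_X "fps_const l"] by simp
  have n: "of_nat (Suc i) = (fps_const (of_nat (Suc i)) :: complex fps)"
    by (simp only: fps_of_nat)
  have r': "ereal (cmod l) < fps_conv_radius ((fps_X - fps_const l) * (fps_deriv ^^ Suc i) f)"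
    "ereal (cmod l) < fps_conv_radius (of_nat (Suc i) * (fps_deriv ^^ i) f)"
     using fps_conv_radius_mult[of "fps_X - fps_const l" "(fps_deriv ^^ Suc i) f"]
       fps_conv_radius_mult[of "of_nat (Suc i)" "(fps_deriv ^^ i) f"] rX r
     unfolding n by (auto simp del: of_nat_Suc funpow.simps intro: less_le_trans)
  have "eval_fps ((fps_deriv ^^ Suc i) ((fps_X - fps_const l) * f)) l
      = of_nat (Suc i) * eval_fps ((fps_deriv ^^ i) f) l"
    unfolding fps_deriv_pow_linear_mult
    using r r' rX unfolding n
    by (simp del: of_nat_Suc funpow.simps add: eval_fps_add eval_fps_mult eval_fps_diff)
  with Suc show ?thesis
    by (simp del: of_nat_Suc funpow.simps add: taylor_coeff_def fact_Suc)
qed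

lemma taylor_coeff_const:
  assumes "cmod l < 1" shows "taylor_coeff l j (fps_const c) = (if j = 0 then c else 0)"
  by (cases j) (simp_all add: taylor_coeff_def del: funpow.simps add: funpow_Suc_right
      fps_deriv_pow_cmult[of _ 0, simplified])

lemma taylor_coeff_X_mult:
  assumes f: "f \<in> wiener" and l: "cmod l < 1"
  shows "taylor_coeff l j (fps_X * f)
      = l * taylor_coeff l j f + (if j = 0 then 0 else taylor_coeff l (j - 1) f)"
proof -
  have "fps_X * f = fps_const l * f + (fps_X - fps_const l) * f" by (simp add: algebra_simps)
  then show ?thesis
    by (simp only:) (subst taylor_coeff_add, auto intro!: wiener_mult wiener_diff
        simp: wiener_X wiener_const f l taylor_coeff_cmult taylor_coeff_linear_mult)
qed

lemma taylor_coeff_surj: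
  assumes l: "cmod l < 1"
  shows "\<exists>h\<in>wiener. \<forall>j<n. taylor_coeff l j h = v j"
proof (induction n arbitrary: v)
  case (Suc n)
  obtain h where h: "h \<in> wiener" "\<forall>j<n. taylor_coeff l j h = v (Suc j)"
    using Suc[of "\<lambda>j. v (Suc j)"] by blast
  let ?h = "fps_const (v 0) + (fps_X - fps_const l) * h"
  have "?h \<in> wiener" by (intro wiener_add wiener_mult wiener_diff wiener_const wiener_X h)
  moreover have "taylor_coeff l j ?h = v j" if "j < Suc n" for j
    using that h
    by (subst taylor_coeff_add) (auto intro!: wiener_mult wiener_diff
        simp: wiener_X wiener_const l taylor_coeff_const taylor_coeff_linear_mult)
  ultimately show ?case by blast
qed (use wiener_0 in auto)

text \<open>
  Cauchy's estimate makes the Taylor coefficients continuous on the Wiener algebra. This is what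
  makes the quotient seminorm definite.
\<close>
lemma taylor_coeff_bound:
  assumes h: "h \<in> wiener" and l: "cmod l < 1"
  shows "cmod (taylor_coeff l j h) \<le> wiener_norm h / ((1 - cmod l) / 2) ^ j"
proof -
  define r where "r = (1 - cmod l) / 2"
  have r: "r > 0" "cmod l + r < 1" using l by (auto simp: r_def field_simps)
  have in1: "cmod z < 1" if "dist l z \<le> r" for z
    using that r norm_triangle_ineq2[of z l] by (simp add: dist_norm norm_minus_commute)
  have hol: "eval_fps h holomorphic_on ball 0 1"
  proof (rule holomorphic_on_eval_fps)
    show "(ball 0 1 :: complex set) \<subseteq> eball 0 (fps_conv_radius h)"
    proof
      fix z :: complex assume "z \<in> ball 0 1"
      then have "ereal (dist 0 z) < 1" by simp
      also have "1 \<le> fps_conv_radius h" by (rule wiener_conv_radius[OF h])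
      finally show "z \<in> eball 0 (fps_conv_radius h)" by (simp add: in_eball_iff)
    qed
  qed
  have "cmod ((deriv ^^ j) (eval_fps h) l) \<le> fact j * wiener_norm h / r ^ j"
  proof (rule Cauchy_inequality)
    show "eval_fps h holomorphic_on ball l r"
      by (rule holomorphic_on_subset[OF hol]) (use in1 in force)
    show "continuous_on (cball l r) (eval_fps h)"
      by (rule holomorphic_on_imp_continuous_on, rule holomorphic_on_subset[OF hol])
          (use in1 in force)
    show "cmod (eval_fps h x) \<le> wiener_norm h" if "cmod (l - x) = r" for x
      using in1[of x] that by (intro wiener_eval_bound h) (auto simp: dist_norm)
  qed (use r in auto)
  then show ?thesis using h l
    by (simp add: taylor_coeff_deriv norm_divide r_def field_simps)
qed

text \<open>
  Splitting off the zeros one factor \<open>z - l\<close> at a time keeps the cofactor in the Wiener algebra, so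
  the cofactor still has an absolutely convergent expansion on the unit circle itself.
\<close>
lemma zero_of_order_factor:
  assumes l: "cmod l < 1"
  shows "h \<in> wiener \<Longrightarrow> \<forall>j<n. taylor_coeff l j h = 0 \<Longrightarrow>
    \<exists>g\<in>wiener. h = (fps_X - fps_const l) ^ n * g"
proof (induction n arbitrary: h)
  case (Suc n)
  have "eval_fps h l = 0" using Suc.prems(2) by (auto simp: taylor_coeff_def)
  with wiener_division[OF Suc.prems(1) l]
  obtain f where f: "f \<in> wiener" "h = (fps_X - fps_const l) * f" by metis
  have "taylor_coeff l j f = 0" if "j < n" for j
    using Suc.prems(2) that taylor_coeff_linear_mult[OF f(1) l, of "Suc j"] f(2) by auto
  with Suc.IH[OF f(1)] obtain g where "g \<in> wiener" "f = (fps_X - fps_const l) ^ n * g" by blast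
  with f(2) show ?case by (auto intro!: bexI[of _ g] simp: mult.assoc)
qed auto

section \<open>An oscillatory integral\<close>

text \<open>
  A second-derivative test of van der Corput type, for a phase with derivative \<open>D\<close> and an
  amplitude \<open>s\<close> that is controlled by \<open>D'\<close>. The usual proof treats the set \<open>\<bar>D\<bar> < sqrt M\<close> around
  the stationary point apart from its complement. Here the smooth partition
  \<open>1 = D\<^sup>2 / (D\<^sup>2 + M) + M / (D\<^sup>2 + M)\<close> does both at once: the first part is integrated by parts,
  using \<open>D E = - \<i> E'\<close>, and whatever then remains is dominated by \<open>1 / (2 sqrt M)\<close> and by
  multiples of \<open>D' / (D\<^sup>2 + M)\<close>, the derivative of \<open>arctan (D / sqrt M) / sqrt M\<close>. As \<open>arctan\<close> is bounded,
  the estimate does not depend on the range of \<open>D\<close>.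
\<close>
lemma van_der_corput_damped:
  fixes E :: "real \<Rightarrow> complex" and s s' D D' :: "real \<Rightarrow> real"
  assumes ab: "a \<le> b" and M: "M > 0" and K: "K \<ge> 0"
    and E: "\<And>t. t \<in> {a..b} \<Longrightarrow> (E has_vector_derivative \<i> * of_real (D t) * E t)
        (at t within {a..b})"
    and E1: "\<And>t. t \<in> {a..b} \<Longrightarrow> cmod (E t) \<le> 1"
    and D: "\<And>t. t \<in> {a..b} \<Longrightarrow> (D has_real_derivative D' t) (at t within {a..b})"
    and s: "\<And>t. t \<in> {a..b} \<Longrightarrow> (s has_real_derivative s' t) (at t within {a..b})"
    and s1: "\<And>t. t \<in> {a..b} \<Longrightarrow> \<bar>s t\<bar> \<le> 1" and s'1: "\<And>t. t \<in> {a..b} \<Longrightarrow> \<bar>s' t\<bar> \<le> 1"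
    and sD: "\<And>t. t \<in> {a..b} \<Longrightarrow> M * \<bar>s t\<bar> \<le> K * D' t"
    and D'0: "\<And>t. t \<in> {a..b} \<Longrightarrow> D' t \<ge> 0"
    and ends: "s a = 0" "s b = 0"
  shows "cmod (integral {a..b} (\<lambda>t. E t * of_real (s t))) \<le> ((b - a) / 2 + (1 + K) * pi) / sqrt M"
proof -
  \<comment> \<open>\<open>F\<close> adds to the integral the boundary term of the partial integration, which vanishes at
      both ends; \<open>G\<close> is a primitive of the bound for the norm of \<open>F'\<close>.\<close>
  define F where "F = (\<lambda>t. integral {a..t} (\<lambda>t. E t * of_real (s t)) + \<i> * E t
      * of_real (s t * D t / ((D t)\<^sup>2 + M)))"
  define F' where "F' = (\<lambda>t. E t * of_real (s t)
     + (\<i> * (\<i> * of_real (D t) * E t) * of_real (s t * D t / ((D t)\<^sup>2 + M))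
     + \<i> * E t * of_real (((s' t * D t + s t * D' t) * ((D t)\<^sup>2 + M) - s t * D t *
         (2 * D t * D' t)) / ((D t)\<^sup>2 + M)\<^sup>2)))"
  define G where "G = (\<lambda>t. t / (2 * sqrt M) + (1 + K) / sqrt M * arctan (D t / sqrt M))"
  define G' where "G' = (\<lambda>t. 1 / (2 * sqrt M) + (1 + K) * (D' t / ((D t)\<^sup>2 + M)))"
  have pos: "(D t)\<^sup>2 + M > 0" for t using M by (simp add: add_nonneg_pos)
  have cE: "continuous_on {a..b} E" by (rule continuous_on_vector_derivative) (rule E)
  have cs: "continuous_on {a..b} s" by (rule DERIV_continuous_on) (rule s)
  have dF: "(F has_vector_derivative F' t) (at t within {a..b})" if t: "t \<in> {a..b}" for t
  proof -
    have q: "((\<lambda>t. s t * D t / ((D t)\<^sup>2 + M)) has_real_derivative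
       ((s' t * D t + s t * D' t) * ((D t)\<^sup>2 + M) - s t * D t * (2 * D t * D' t)) /
           ((D t)\<^sup>2 + M)\<^sup>2) (at t within {a..b})"
      using pos[of t] by (auto intro!: derivative_eq_intros s[OF t] D[OF t] simp: power2_eq_square
        algebra_simps)
    have i: "((\<lambda>t. integral {a..t} (\<lambda>t. E t * of_real (s t))) has_vector_derivative E t
        * of_real (s t)) (at t within {a..b})"
      by (rule integral_has_vector_derivative[OF _ t]) (intro continuous_intros cE cs)
    have q': "((\<lambda>t. complex_of_real (s t * D t / ((D t)\<^sup>2 + M))) has_vector_derivative
       of_real (((s' t * D t + s t * D' t) * ((D t)\<^sup>2 + M) - s t * D t * (2 * D t * D' t)) /
           ((D t)\<^sup>2 + M)\<^sup>2)) (at t within {a..b})"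
      by (rule has_vector_derivative_of_real)
          (use q in \<open>simp only: has_real_derivative_iff_has_vector_derivative\<close>)
    have e: "((\<lambda>t. \<i> * E t) has_vector_derivative \<i> * (\<i> * of_real (D t) * E t))
        (at t within {a..b})"
      by (rule has_vector_derivative_mult_right[OF E[OF t]])
    show ?thesis unfolding F_def F'_def
      using has_vector_derivative_add[OF i has_vector_derivative_mult[OF e q']]
      by (simp add: algebra_simps)
  qed
  have dG: "(G has_vector_derivative G' t) (at t within {a..b})" if t: "t \<in> {a..b}" for t
  proof -
    have "(G has_real_derivative G' t) (at t within {a..b})"
    proof -
      have "((\<lambda>t. D t / sqrt M) has_real_derivative D' t / sqrt M) (at t within {a..b})"
        by (rule DERIV_cdivide[OF D[OF t]])
      from DERIV_chain2[OF DERIV_arctan this]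
      have "((\<lambda>t. arctan (D t / sqrt M)) has_real_derivative
          inverse (1 + (D t / sqrt M)\<^sup>2) * (D' t / sqrt M)) (at t within {a..b})" .
      then have "(G has_real_derivative 1 / (2 * sqrt M) +
          (1 + K) / sqrt M * (inverse (1 + (D t / sqrt M)\<^sup>2) * (D' t / sqrt M))) (at t within
              {a..b})"
        unfolding G_def by (intro DERIV_add DERIV_cdivide DERIV_ident DERIV_cmult)
      also have "1 + (D t / sqrt M)\<^sup>2 = ((D t)\<^sup>2 + M) / M"
        using M by (simp add: power_divide field_simps)
      also have "(1 + K) / sqrt M * (inverse (((D t)\<^sup>2 + M) / M) * (D' t / sqrt M)) =
          (1 + K) * (D' t * (M / (sqrt M * sqrt M)) / ((D t)\<^sup>2 + M))"
        by (simp add: field_simps)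
      also have "M / (sqrt M * sqrt M) = 1" using M by simp
      finally show ?thesis by (simp add: G'_def)
    qed
    then show ?thesis by (simp only: has_real_derivative_iff_has_vector_derivative)
  qed
  have le: "norm (F' t) \<le> G' t" if t: "t \<in> {a..b}" for t
  proof -
    define w where "w = (D t)\<^sup>2 + M"
    have w: "w > 0" "M \<le> w" "\<bar>M - (D t)\<^sup>2\<bar> \<le> w" using pos[of t] M zero_le_power2[of "D t"]
      unfolding w_def by linarith+
    have "F' t = E t * of_real (s t * M / w) + \<i> * E t
        * of_real (s' t * D t / w + s t * D' t * (M - (D t)\<^sup>2) / w\<^sup>2)"
    proof -
      have 1: "s t - D t * (s t * D t / w) = s t * M / w"
        using w by (simp add: field_simps w_def power2_eq_square)
      have 2: "((s' t * D t + s t * D' t) * w - s t * D t * (2 * D t * D' t)) / w\<^sup>2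
         = s' t * D t / w + s t * D' t * (M - (D t)\<^sup>2) / w\<^sup>2"
      proof -
        have "((s' t * D t + s t * D' t) * w - s t * D t * (2 * D t * D' t))
          = s' t * D t * w + s t * D' t * (M - (D t)\<^sup>2)"
          by (simp add: w_def power2_eq_square algebra_simps)
        then show ?thesis using w by (simp add: add_divide_distrib power2_eq_square)
      qed
      have "F' t = E t * of_real (s t - D t * (s t * D t / w)) + \<i> * E t *
          of_real (((s' t * D t + s t * D' t) * w - s t * D t * (2 * D t * D' t)) / w\<^sup>2)"
        unfolding F'_def w_def[symmetric] by (simp add: algebra_simps)
      then show ?thesis unfolding 1 2 .
    qed
    also have "norm \<dots> \<le> \<bar>s t * M / w\<bar> + \<bar>s' t * D t / w + s t * D' t * (M - (D t)\<^sup>2) / w\<^sup>2\<bar>"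
    proof (rule order_trans[OF norm_triangle_ineq], rule add_mono)
      have "cmod (E t) * y \<le> y" if "y \<ge> 0" for y
        using E1[OF t] that by (intro mult_left_le_one_le) auto
      then show "cmod (E t * of_real (s t * M / w)) \<le> \<bar>s t * M / w\<bar>"
        "cmod (\<i> * E t * of_real (s' t * D t / w + s t * D' t * (M - (D t)\<^sup>2) / w\<^sup>2))
          \<le> \<bar>s' t * D t / w + s t * D' t * (M - (D t)\<^sup>2) / w\<^sup>2\<bar>"
        by (simp_all only: norm_mult norm_of_real norm_ii mult_1_left abs_ge_zero)
    qed
    also have "\<dots> \<le> \<bar>s t * M / w\<bar> + (\<bar>s' t * D t / w\<bar> + \<bar>s t * D' t * (M - (D t)\<^sup>2) / w\<^sup>2\<bar>)"
      by (intro add_left_mono abs_triangle_ineq)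
    also have "\<dots> \<le> K * D' t / w + (1 / (2 * sqrt M) + D' t / w)"
    proof (intro add_mono)
      show "\<bar>s t * M / w\<bar> \<le> K * D' t / w"
        using sD[OF t] w M by (auto simp: abs_mult divide_simps mult.commute)
      have "2 * sqrt M * \<bar>D t\<bar> \<le> w"
        using zero_le_power2[of "\<bar>D t\<bar> - sqrt M"] M by (simp add: power2_diff w_def algebra_simps)
      then have *: "\<bar>D t\<bar> / w \<le> 1 / (2 * sqrt M)" using w M by (simp add: field_simps)
      have "\<bar>s' t * D t / w\<bar> = \<bar>s' t\<bar> * (\<bar>D t\<bar> / w)" using w by (simp add: abs_mult)
      also have "\<dots> \<le> \<bar>D t\<bar> / w" by (rule mult_left_le_one_le) (use w s'1[OF t] in auto)
      finally show "\<bar>s' t * D t / w\<bar> \<le> 1 / (2 * sqrt M)" using * by simp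
      have "\<bar>s t * D' t * (M - (D t)\<^sup>2) / w\<^sup>2\<bar> = \<bar>s t\<bar> * (D' t / w * (\<bar>M - (D t)\<^sup>2\<bar> / w))"
        using w D'0[OF t] by (simp add: abs_mult power2_eq_square)
      also have "\<dots> \<le> D' t / w * (\<bar>M - (D t)\<^sup>2\<bar> / w)"
        by (rule mult_left_le_one_le) (use w s1[OF t] D'0[OF t] in auto)
      also have "\<dots> \<le> D' t / w"
        by (rule mult_left_le) (use w D'0[OF t] in auto)
      finally show "\<bar>s t * D' t * (M - (D t)\<^sup>2) / w\<^sup>2\<bar> \<le> D' t / w" .
    qed
    also have "\<dots> = G' t" by (simp add: G'_def w_def distrib_right add_divide_distrib)
    finally show ?thesis .
  qed
  have "norm (F b - F a) \<le> G b - G a"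
  proof -
    have "(F' has_integral (F b - F a)) {a..b}" "(G' has_integral (G b - G a)) {a..b}"
      using dF dG ab by (auto intro!: fundamental_theorem_of_calculus)
    then have "norm (integral {a..b} F') \<le> integral {a..b} G'"
      using le by (intro integral_norm_bound_integral) auto
    then show ?thesis
      using \<open>(F' has_integral (F b - F a)) {a..b}\<close> \<open>(G' has_integral (G b - G a)) {a..b}\<close>
      by (simp add: integral_unique)
  qed
  also have "F b - F a = integral {a..b} (\<lambda>t. E t * of_real (s t))"
    by (simp add: F_def ends)
  also have "G b - G a \<le> ((b - a) / 2 + (1 + K) * pi) / sqrt M"
  proof -
    have "arctan (D b / sqrt M) - arctan (D a / sqrt M) \<le> pi"
      using arctan_bounded[of "D b / sqrt M"] arctan_bounded[of "D a / sqrt M"] by linarith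
    then have "(1 + K) / sqrt M * (arctan (D b / sqrt M) - arctan (D a / sqrt M))
        \<le> (1 + K) / sqrt M * pi"
      using K M by (intro mult_left_mono) auto
    moreover have "G b - G a = (b - a) / (2 * sqrt M) +
        (1 + K) / sqrt M * (arctan (D b / sqrt M) - arctan (D a / sqrt M))"
      by (simp add: G_def diff_divide_distrib right_diff_distrib)
    moreover have "((b - a) / 2 + (1 + K) * pi) / sqrt M = (b - a) / (2 * sqrt M) + (1 + K)
        / sqrt M * pi"
      by (simp add: add_divide_distrib distrib_right)
    ultimately show ?thesis by linarith
  qed
  finally show ?thesis .
qed

section \<open>Powers of a Blaschke factor on the unit circle\<close>

lemma has_vector_derivative_cis_mult:
  "((\<lambda>t. cis (c * t)) has_vector_derivative of_real c * (\<i> * cis (c * t))) (at t within S)"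
  unfolding has_vector_derivative_def
  using has_derivative_cis[of "\<lambda>t. c * t" "\<lambda>t. c * t" t S]
  by (auto intro!: derivative_eq_intros simp: scaleR_conv_of_real mult_ac)

definition poisson_kernel :: "real \<Rightarrow> real \<Rightarrow> real" where
  "poisson_kernel r t = (1 - r\<^sup>2) / (1 - 2 * r * cos t + r\<^sup>2)"

text \<open>
  On the unit circle the reciprocal of the Blaschke factor \<open>b(z) = (z - r) / (1 - r z)\<close> is its
  complex conjugate, so this is \<open>z ^ (k + 1) \<cdot> cnj (b z) ^ n\<close> at \<open>z = cis t\<close>. The exponent is
  \<open>k + 1\<close> since \<open>1 - z\<^sup>2 = - 2 \<i> z sin t\<close> contributes one more factor \<open>z\<close> to the \<open>k\<close>-th
  Fourier coefficient.
\<close>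
definition blaschke_wave :: "real \<Rightarrow> nat \<Rightarrow> nat \<Rightarrow> real \<Rightarrow> complex" where
  "blaschke_wave r n k t = cis t ^ Suc k * ((1 - of_real r * cis t) / (cis t - of_real r)) ^ n"

lemma poisson_denominator_pos:
  fixes t :: real
  assumes "0 < r" "r < 1"
  shows "1 - 2 * r * cos t + r\<^sup>2 > 0" "1 - 2 * r * cos t + r\<^sup>2 \<le> (1 + r)\<^sup>2"
proof -
  have "2 * r * cos t \<le> 2 * r" "- (2 * r * cos t) \<le> 2 * r"
    using assms cos_le_one[of t] mult_left_mono[of "- cos t" 1 "2 * r"] cos_ge_minus_one[of t]
      by auto
  moreover have "(1 - r)\<^sup>2 > 0" using assms by simp
  ultimately show "1 - 2 * r * cos t + r\<^sup>2 > 0" "1 - 2 * r * cos t + r\<^sup>2 \<le> (1 + r)\<^sup>2"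
    by (simp_all add: power2_diff power2_sum)
qed

lemma circle_factor:
  "(cis t - of_real r) * (1 - of_real r * cis t) = cis t * of_real (1 - 2 * r * cos t + r\<^sup>2)"
proof -
  have c: "of_real (2 * cos t) * cis t = cis t ^ 2 + 1"
    by (simp add: complex_eq_iff power2_eq_square cos_squared_eq algebra_simps)
  have "cis t * of_real (1 - 2 * r * cos t + r\<^sup>2) = cis t + of_real r ^ 2 * cis t - of_real r
      * (of_real (2 * cos t) * cis t)"
    by (simp add: algebra_simps)
  then show ?thesis unfolding c by (simp add: algebra_simps power2_eq_square)
qed

lemma cis_neq_real: "0 < r \<Longrightarrow> r < 1 \<Longrightarrow> cis t \<noteq> of_real r"
  by (metis abs_of_pos less_irrefl norm_cis norm_of_real)

lemma norm_blaschke_wave: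
  assumes "0 < r" "r < 1"
  shows "cmod (blaschke_wave r n k t) = 1"
proof -
  have "1 - of_real r * cis t = cis t * cnj (cis t - of_real r)"
    by (simp add: right_diff_distrib cis_cnj cis_mult)
  then have "cmod (1 - of_real r * cis t) = cmod (cis t - of_real r)"
    by (simp only: norm_mult complex_mod_cnj norm_cis)
  then show ?thesis using cis_neq_real[OF assms, of t]
    by (simp add: blaschke_wave_def norm_mult norm_power norm_divide)
qed

text \<open>
  The logarithmic derivative of \<open>b\<close> along the circle is the Poisson kernel, so the phase of the
  wave has the real derivative \<open>k + 1 - n P(t)\<close>. Working with this differential equation avoids
  choosing a branch of the argument.
\<close>
lemma blaschke_wave_derivative:
  assumes r: "0 < r" "r < 1"
  shows "(blaschke_wave r n k has_vector_derivative
    \<i> * of_real (real (Suc k) - real n * poisson_kernel r t) * blaschke_wave r n k t) (at t within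
        S)"
proof -
  define z where "z = cis t"
  define q where "q = complex_of_real (1 - 2 * r * cos t + r\<^sup>2)"
  define B where "B = (1 - of_real r * z) / (z - of_real r)"
  have zr: "z - of_real r \<noteq> 0" using cis_neq_real[OF r, of t] by (simp add: z_def)
  have q0: "q \<noteq> 0" using poisson_denominator_pos(1)[OF r, of t] unfolding q_def of_real_eq_0_iff
      by simp
  have fac: "(z - of_real r) * (1 - of_real r * z) = z * q"
    unfolding z_def q_def by (rule circle_factor)
  let ?f = "\<lambda>w. w ^ Suc k * ((1 - of_real r * w) / (w - of_real r)) ^ n :: complex"
  let ?d = "of_nat (Suc k) * z ^ k * B ^ n + z ^ Suc k
      * (of_nat n * B ^ (n - 1) * ((of_real r ^ 2 - 1) / (z - of_real r)\<^sup>2))"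
  have dB: "((\<lambda>w. (1 - of_real r * w) / (w - of_real r)) has_field_derivative ((of_real r ^ 2 - 1)
      / (z - of_real r)\<^sup>2)) (at z)"
    by (rule derivative_eq_intros refl | use zr in \<open>simp; fail\<close>)+
       (simp add: field_simps power2_eq_square)
  have "(?f has_field_derivative ?d) (at z)"
  proof -
    have "((\<lambda>w. w ^ Suc k) has_field_derivative of_nat (Suc k) * z ^ k) (at z)"
      using DERIV_power[OF DERIV_ident[where F = "at z"], where n = "Suc k"] by simp
    from DERIV_mult[OF this DERIV_power[OF dB, where n = n]] show ?thesis
      by (simp add: B_def algebra_simps)
  qed
  moreover have "(cis has_vector_derivative \<i> * z) (at t within S)"
    using has_vector_derivative_cis_mult[of 1 t S] by (simp add: z_def)
  ultimately have "(?f \<circ> cis has_vector_derivative (\<i> * z * ?d)) (at t within S)"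
    unfolding z_def by (intro field_vector_diff_chain_within)
        (auto intro: has_field_derivative_at_within)
  moreover have "?f \<circ> cis = blaschke_wave r n k" by (auto simp: blaschke_wave_def)
  moreover have "\<i> * z * ?d = \<i> * of_real (real (Suc k) - real n * poisson_kernel r t)
      * blaschke_wave r n k t"
  proof -
    have P: "of_real (poisson_kernel r t) = (1 - of_real r ^ 2) / q"
      by (simp add: poisson_kernel_def q_def)
    have "z * ((of_real r ^ 2 - 1) / (z - of_real r)\<^sup>2) = - (of_real (poisson_kernel r t) * B)"
    proof -
      have "z / (z - of_real r) = (1 - of_real r * z) / q"
        using zr q0 fac by (simp add: frac_eq_eq mult.commute)
      moreover have "z * ((of_real r ^ 2 - 1) / (z - of_real r)\<^sup>2) =
          (of_real r ^ 2 - 1) / (z - of_real r) * (z / (z - of_real r))"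
        by (simp add: power2_eq_square)
      ultimately have "z * ((of_real r ^ 2 - 1) / (z - of_real r)\<^sup>2) =
          (- (1 - of_real r ^ 2)) * (1 - of_real r * z) / ((z - of_real r) * q)"
        by simp
      also have "\<dots> = - ((1 - of_real r ^ 2) * (1 - of_real r * z) / ((z - of_real r) * q))"
        by (simp only: mult_minus_left minus_divide_left)
      finally show ?thesis by (simp add: P B_def mult_ac)
    qed
    moreover have "z * (of_nat n * B ^ (n - 1) * d) = - (of_nat n * p * B ^ n)"
      if "z * d = - (p * B)" for d p
    proof -
      have "z * (of_nat n * B ^ (n - 1) * d) = of_nat n * B ^ (n - 1) * (z * d)"
        by (simp only: mult_ac)
      then show ?thesis unfolding that by (cases n) simp_all
    qed
    ultimately have Y: "z * (of_nat n * B ^ (n - 1) * ((of_real r ^ 2 - 1) / (z - of_real r)\<^sup>2)) =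
        - (of_nat n * of_real (poisson_kernel r t) * B ^ n)" by blast
    have "z * ?d = z ^ Suc k * of_nat (Suc k) * B ^ n +
        z ^ Suc k * (z * (of_nat n * B ^ (n - 1) * ((of_real r ^ 2 - 1) / (z - of_real r)\<^sup>2)))"
      by (simp only: distrib_left power_Suc mult_ac)
    then have zd: "z * ?d = z ^ Suc k * of_nat (Suc k) * B ^ n +
        z ^ Suc k * (- (of_nat n * of_real (poisson_kernel r t) * B ^ n))"
      unfolding Y .
    have wave: "blaschke_wave r n k t = z ^ Suc k * B ^ n"
      by (simp only: blaschke_wave_def z_def B_def)
    have "\<i> * z * ?d = \<i> * (z * ?d)" by (rule mult.assoc)
    also have "\<dots> = \<i> * of_real (real (Suc k) - real n * poisson_kernel r t) * (z ^ Suc k * B ^ n)"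
      unfolding zd by (simp add: algebra_simps)
    finally show ?thesis unfolding wave .
  qed
  ultimately show ?thesis by (simp only:)
qed

lemma poisson_kernel_derivative:
  assumes r: "0 < r" "r < 1"
  shows "(poisson_kernel r has_real_derivative
    - ((1 - r\<^sup>2) * (2 * r * sin t) / (1 - 2 * r * cos t + r\<^sup>2)\<^sup>2)) (at t within S)"
  unfolding poisson_kernel_def using poisson_denominator_pos(1)[OF r, of t]
  by (auto intro!: derivative_eq_intros simp: power2_eq_square)

text \<open>
  With \<open>P\<close> the Poisson kernel, \<open>\<bar>sin t\<bar>\<close> is at most \<open>wave_const r\<close> times \<open>\<bar>P'(t)\<bar>\<close>: both vanish
  exactly at \<open>z = 1\<close> and \<open>z = -1\<close>.
\<close>
definition wave_const :: "real \<Rightarrow> real" where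
  "wave_const r = (1 + r) ^ 4 / (2 * r * (1 - r\<^sup>2))"

lemma sin_le_phase_derivative:
  assumes r: "0 < r" "r < 1"
  shows "\<bar>sin t\<bar> \<le> wave_const r * ((1 - r\<^sup>2) * (2 * r * \<bar>sin t\<bar>) / (1 - 2 * r * cos t + r\<^sup>2)\<^sup>2)"
proof -
  define q where "q = 1 - 2 * r * cos t + r\<^sup>2"
  have q: "q > 0" "q \<le> (1 + r)\<^sup>2" unfolding q_def by (rule poisson_denominator_pos[OF r])+
  have r2: "1 - r\<^sup>2 > 0" using r by (simp add: power_less_one_iff)
  have "q\<^sup>2 \<le> ((1 + r)\<^sup>2)\<^sup>2" using q by (intro power_mono) auto
  then have "1 \<le> (1 + r) ^ 4 / q\<^sup>2" using q by (simp add: le_divide_eq flip: power_mult)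
  then have "\<bar>sin t\<bar> * 1 \<le> \<bar>sin t\<bar> * ((1 + r) ^ 4 / q\<^sup>2)" by (intro mult_left_mono) auto
  also have "\<dots> = wave_const r * ((1 - r\<^sup>2) * (2 * r * \<bar>sin t\<bar>) / q\<^sup>2)"
    using r r2 q by (simp add: wave_const_def)
  finally show ?thesis by (simp add: q_def)
qed

lemma wave_const_pos: "0 < r \<Longrightarrow> r < 1 \<Longrightarrow> wave_const r > 0"
  by (simp add: wave_const_def power_less_one_iff)

text \<open>
  The Poisson kernel is decreasing on \<open>[0, \<pi>]\<close> and increasing on \<open>[-\<pi>, 0]\<close>, so on each half
  the damped van der Corput estimate applies with \<open>M = n\<close>, on the second half after complex
  conjugation, which changes the sign of the phase.
\<close>
lemma blaschke_wave_integral_bound: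
  assumes r: "0 < r" "r < 1" and n: "n \<ge> 1"
  shows "cmod (integral {-pi..pi} (\<lambda>t. blaschke_wave r n k t * of_real (sin t))) \<le>
    pi * (3 + 2 * wave_const r) / sqrt (real n)"
proof -
  define K where "K = wave_const r"
  define E where "E = blaschke_wave r n k"
  define D where "D = (\<lambda>t. real (Suc k) - real n * poisson_kernel r t)"
  define D' where "D' = (\<lambda>t. real n
      * ((1 - r\<^sup>2) * (2 * r * sin t) / (1 - 2 * r * cos t + r\<^sup>2)\<^sup>2))"
  have r2: "1 - r\<^sup>2 > 0" using r by (simp add: power_less_one_iff)
  have K: "K \<ge> 0" using wave_const_pos[OF r] by (simp add: K_def)
  have dE: "(E has_vector_derivative \<i> * of_real (D t) * E t) (at t within S)" for t S
    unfolding E_def D_def by (rule blaschke_wave_derivative[OF r])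
  have dD: "(D has_real_derivative D' t) (at t within S)" for t S
    unfolding D_def D'_def
    by (rule derivative_eq_intros poisson_kernel_derivative[OF r] refl | simp)+
  have sD: "real n * \<bar>sin t\<bar> \<le> K * \<bar>D' t\<bar>" for t
    using mult_left_mono[OF sin_le_phase_derivative[OF r, of t], of "real n"] r r2
    by (simp add: D'_def K_def abs_mult mult_ac)
  have 1: "cmod (integral {0..pi} (\<lambda>t. E t * of_real (sin t))) \<le> ((pi - 0) / 2 + (1 + K) * pi)
      / sqrt (real n)"
  proof (rule van_der_corput_damped[where D = D and D' = D' and s' = cos])
    fix t assume "t \<in> {0..pi}"
    then have "sin t \<ge> 0" by (auto intro: sin_ge_zero)
    then show D'0: "D' t \<ge> 0" using r r2 by (auto simp: D'_def)
    show "real n * \<bar>sin t\<bar> \<le> K * D' t" using sD[of t] D'0 by simp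
  qed (use n K dE dD r in \<open>auto simp: E_def norm_blaschke_wave intro!: derivative_eq_intros\<close>)
  have "cmod (integral {-pi..0} (\<lambda>t. cnj (E t) * of_real (sin t)))
      \<le> ((0 - (- pi)) / 2 + (1 + K) * pi) / sqrt (real n)"
  proof (rule van_der_corput_damped[where D = "\<lambda>t. - D t" and D' = "\<lambda>t. - D' t" and s' = cos])
    fix t assume "t \<in> {-pi..0}"
    then have "sin t \<le> 0" using sin_ge_zero[of "-t"] by auto
    then show D'0: "- D' t \<ge> 0" using r r2
        by (auto simp: D'_def intro!: mult_nonneg_nonpos divide_nonpos_nonneg)
    show "real n * \<bar>sin t\<bar> \<le> K * (- D' t)" using sD[of t] D'0 by simp
    show "((\<lambda>t. cnj (E t)) has_vector_derivative \<i> * of_real (- D t) * cnj (E t))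
        (at t within {-pi..0})"
      using has_vector_derivative_cnj[OF dE[of t "{-pi..0}"]] by simp
    show "((\<lambda>t. - D t) has_real_derivative - D' t) (at t within {-pi..0})"
      by (rule DERIV_minus[OF dD])
  qed (use n K r in \<open>auto simp: E_def norm_blaschke_wave intro!: derivative_eq_intros\<close>)
  also have "integral {-pi..0} (\<lambda>t. cnj (E t) * of_real (sin t))
      = cnj (integral {-pi..0} (\<lambda>t. E t * of_real (sin t)))"
  proof -
    have "continuous_on {-pi..0} E" by (rule continuous_on_vector_derivative) (rule dE)
    then have "(\<lambda>t. E t * of_real (sin t)) integrable_on {-pi..0}"
      by (intro integrable_continuous_interval continuous_intros)
    then show ?thesis
      using has_integral_cnj[of "\<lambda>t. E t
        * of_real (sin t)" "integral {-pi..0} (\<lambda>t. E t * of_real (sin t))" "{-pi..0}"]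
      by (auto simp: o_def integrable_integral intro!: integral_unique)
  qed
  finally have 2: "cmod (integral {-pi..0} (\<lambda>t. E t * of_real (sin t)))
      \<le> (pi / 2 + (1 + K) * pi) / sqrt (real n)"
    by simp
  have "continuous_on {-pi..pi} E" by (rule continuous_on_vector_derivative) (rule dE)
  then have "(\<lambda>t. E t * of_real (sin t)) integrable_on {-pi..pi}"
    by (intro integrable_continuous_interval continuous_intros)
  then have "integral {-pi..pi} (\<lambda>t. E t * of_real (sin t)) =
     integral {-pi..0} (\<lambda>t. E t * of_real (sin t)) + integral {0..pi} (\<lambda>t. E t * of_real (sin t))"
    by (intro Henstock_Kurzweil_Integration.integral_combine[symmetric]) auto
  also have "cmod \<dots> \<le> (pi / 2 + (1 + K) * pi) / sqrt (real n) + (pi / 2 + (1 + K) * pi)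
      / sqrt (real n)"
    using norm_triangle_le[OF add_mono[OF 2 1]] by simp
  also have "\<dots> = pi * (3 + 2 * wave_const r) / sqrt (real n)"
    by (simp add: K_def field_simps)
  finally show ?thesis by (simp add: E_def)
qed

section \<open>Pairing Wiener functions with powers of a Blaschke factor\<close>

lemma wiener_integral_termwise:
  assumes f: "f \<in> wiener" and w: "cmod w = 1" and u: "continuous_on {a..b} u"
  shows "(\<lambda>k. fps_nth f k * w ^ k * integral {a..b} (\<lambda>t. cis t ^ k * u t)) sums
    integral {a..b} (\<lambda>t. eval_fps f (w * cis t) * u t)"
proof -
  have "\<exists>C. \<forall>t\<in>{a..b}. cmod (u t) \<le> C"
    using compact_imp_bounded[OF compact_continuous_image[OF u compact_Icc]]
      by (auto simp: bounded_iff)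
  then obtain C where C: "\<And>t. t \<in> {a..b} \<Longrightarrow> cmod (u t) \<le> C" by blast
  let ?F = "\<lambda>k t. fps_nth f k * (w * cis t) ^ k * u t"
  have le: "cmod (?F k t) \<le> cmod (fps_nth f k) * C" if "t \<in> {a..b}" for k t
    using C[OF that] w by (auto simp: norm_mult norm_power intro!: mult_left_mono)
  have "uniform_limit {a..b} (\<lambda>n t. \<Sum>k<n. ?F k t) (\<lambda>t. \<Sum>k. ?F k t) sequentially"
    by (rule Weierstrass_m_test[OF le]) (auto intro!: summable_mult2 wiener_summable f)
  then obtain I J where IJ: "\<And>n. ((\<lambda>t. \<Sum>k<n. ?F k t) has_integral I n) {a..b}"
    "((\<lambda>t. \<Sum>k. ?F k t) has_integral J) {a..b}" "I \<longlonglongrightarrow> J"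
    by (rule uniform_limit_integral) (auto intro!: continuous_intros u)
  have int: "(\<lambda>t. cis t ^ k * u t) integrable_on {a..b}" for k
    by (intro integrable_continuous_interval continuous_intros u)
  have "I n = (\<Sum>k<n. fps_nth f k * w ^ k * integral {a..b} (\<lambda>t. cis t ^ k * u t))" for n
  proof -
    have "((\<lambda>t. \<Sum>k<n. fps_nth f k * w ^ k * (cis t ^ k * u t)) has_integral
       (\<Sum>k<n. fps_nth f k * w ^ k * integral {a..b} (\<lambda>t. cis t ^ k * u t))) {a..b}"
      by (intro has_integral_sum has_integral_mult_right integrable_integral int) auto
    then show ?thesis using IJ(1)[of n]
      by (simp add: power_mult_distrib mult_ac has_integral_unique)
  qed
  then have "I = (\<lambda>n. \<Sum>k<n. fps_nth f k * w ^ k * integral {a..b} (\<lambda>t. cis t ^ k * u t))"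
    by blast
  moreover have "(\<Sum>k. ?F k t) = eval_fps f (w * cis t) * u t" for t
    unfolding eval_fps_def
    by (rule suminf_mult2[symmetric], rule summable_norm_cancel, rule wiener_eval_summable)
       (use f w in \<open>auto simp: norm_mult\<close>)
  ultimately show ?thesis using IJ(2,3) by (simp add: sums_def integral_unique)
qed

lemma integral_cis_power: "integral {-pi..pi} (\<lambda>t. cis t ^ k)
    = (if k = 0 then 2 * of_real pi else 0)"
proof (cases "k = 0")
  case False
  have "((\<lambda>t. cis t ^ k) has_integral (cis pi ^ k / (\<i> * of_nat k) - cis (-pi) ^ k
      / (\<i> * of_nat k))) {-pi..pi}"
  proof (rule fundamental_theorem_of_calculus)
    fix t :: real
    have "((\<lambda>t. cis (real k * t) / (\<i> * of_nat k)) has_vector_derivative cis (real k * t))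
        (at t within {-pi..pi})"
      using False has_vector_derivative_mult_right[OF
        has_vector_derivative_cis_mult[of "real k" t "{-pi..pi}"],
          of "inverse (\<i> * of_nat k)"]
      by (simp add: field_simps)
    then show "((\<lambda>t. cis t ^ k / (\<i> * of_nat k)) has_vector_derivative cis t ^ k)
        (at t within {-pi..pi})"
      by (simp add: Complex.DeMoivre)
  qed simp
  moreover have "cis (-pi) = cis pi" by (simp add: complex_eq_iff)
  ultimately show ?thesis using False by (simp add: integral_unique)
qed (simp add: scaleR_conv_of_real)

text \<open>
  Two evaluations of \<open>\<integral> h(w z) \<cdot> cnj (b(z)) ^ n \<cdot> (1 - z\<^sup>2)\<close> over the unit circle, where
  \<open>h = (z - l) ^ n g\<close>, the factor \<open>w\<close> rotates the positive number \<open>r = \<bar>l\<bar>\<close> onto \<open>l = r w\<close>, and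
  \<open>b\<close> is the Blaschke factor with zero \<open>r\<close>.
  Cancelling the zeros of \<open>h\<close> against \<open>cnj b ^ n\<close> leaves a
  Wiener function with constant coefficient \<open>g(0)\<close>; expanding \<open>h\<close> leaves its coefficients against
  integrals of Blaschke waves.
\<close>
lemma wiener_norm_lower_bound:
  assumes l: "l \<noteq> 0" "cmod l < 1" and n: "n \<ge> 1" and g: "g \<in> wiener"
  shows "cmod (fps_nth g 0) * sqrt (real n) \<le>
    (3 + 2 * wave_const (cmod l)) * wiener_norm ((fps_X - fps_const l) ^ n * g)"
proof -
  define r where "r = cmod l"
  define w where "w = l / of_real r"
  define h where "h = (fps_X - fps_const l) ^ n * g"
  define G where "G = (1 - fps_const (cnj l) * fps_X) ^ n
      * (1 - fps_const ((cnj w)\<^sup>2) * fps_X ^ 2) * g"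
  define I where "I = (\<lambda>k. integral {-pi..pi} (\<lambda>t. blaschke_wave r n k t * of_real (sin t)))"
  define C where "C = 3 + 2 * wave_const r"
  define B where "B = (\<lambda>t. ((1 - of_real r * cis t) / (cis t - of_real r)) ^ n)"
  have r: "0 < r" "r < 1" using l by (auto simp: r_def)
  have w1: "cmod w = 1" and lw: "l = of_real r * w" using r
      by (auto simp: w_def r_def norm_divide)
  have ww: "cnj w * w = 1" using complex_norm_square[of w] w1 by (simp add: mult.commute)
  have zr: "cis t \<noteq> of_real r" for t by (rule cis_neq_real[OF r])
  have W1: "(1::complex fps) \<in> wiener" using wiener_const(1)[of 1] by simp
  note W = wiener_mult wiener_power wiener_diff wiener_X wiener_const(1) W1
  have hW: "h \<in> wiener" and GW: "G \<in> wiener" unfolding h_def G_def by (intro W g)+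
  have G0: "fps_nth G 0 = fps_nth g 0"
    by (simp add: G_def fps_nth_power_0 fps_X_power_iff)
  have cB: "continuous_on {-pi..pi} B" unfolding B_def
      by (intro continuous_intros) (use zr in auto)
  have id: "eval_fps h (w * cis t) * (B t * (cis t * of_real (sin t)) * (- 2 * \<i>))
      = w ^ n * eval_fps G (w * cis t)" for t
  proof -
    have c: "cmod (w * cis t) \<le> 1" using w1 by (simp add: norm_mult)
    have "eval_fps h (w * cis t) = (w * (cis t - of_real r)) ^ n * eval_fps g (w * cis t)"
      unfolding h_def using c
      by (simp add: wiener_eval_mult wiener_eval_power wiener_eval_diff W g lw)
          (simp add: algebra_simps)
    then have 1: "eval_fps h (w * cis t) * B t = w ^ n * (1 - of_real r * cis t) ^ n
        * eval_fps g (w * cis t)"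
      using zr[of t] by (simp add: B_def power_mult_distrib power_divide)
    have 2: "cis t * of_real (sin t) * (- 2 * \<i>) = 1 - cis t ^ 2"
      by (simp add: complex_eq_iff power2_eq_square cos_squared_eq algebra_simps)
    have "eval_fps G (w * cis t) = (1 - cnj l * (w * cis t)) ^ n * (1 - (cnj w)\<^sup>2 * (w * cis t)\<^sup>2)
        * eval_fps g (w * cis t)"
      unfolding G_def using c
      by (simp add: wiener_eval_mult wiener_eval_power wiener_eval_diff W g)
    also have "cnj l * (w * cis t) = of_real r * cis t" using ww by (simp add: lw)
    also have "(cnj w)\<^sup>2 * (w * cis t)\<^sup>2 = cis t ^ 2"
      using ww by (simp flip: power_mult_distrib mult.assoc)
    finally show ?thesis using 1 2 by (simp add: mult_ac)
  qed
  have "(\<lambda>k. fps_nth G k * w ^ k * integral {-pi..pi} (\<lambda>t. cis t ^ k * 1)) sums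
     integral {-pi..pi} (\<lambda>t. eval_fps G (w * cis t) * 1)"
    by (rule wiener_integral_termwise[OF GW w1]) simp
  moreover have "(\<lambda>k. fps_nth G k * w ^ k * integral {-pi..pi} (\<lambda>t. cis t ^ k * 1)) =
     (\<lambda>k. if k = 0 then 2 * of_real pi * fps_nth g 0 else 0)"
    by (auto simp: integral_cis_power G0)
  ultimately have intG: "integral {-pi..pi} (\<lambda>t. eval_fps G (w * cis t))
      = 2 * of_real pi * fps_nth g 0"
    using sums_single[of 0 "\<lambda>k. 2 * of_real pi * fps_nth g 0"] by (auto dest: sums_unique2)
  have "(\<lambda>k. fps_nth h k * w ^ k
      * integral {-pi..pi} (\<lambda>t. cis t ^ k * (B t * (cis t * of_real (sin t))))) sums
      integral {-pi..pi} (\<lambda>t. eval_fps h (w * cis t) * (B t * (cis t * of_real (sin t))))"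
    by (rule wiener_integral_termwise[OF hW w1]) (intro continuous_intros cB)
  moreover have "cis t ^ k * (B t * (cis t * of_real (sin t)))
      = blaschke_wave r n k t * of_real (sin t)" for k t
    by (simp add: blaschke_wave_def B_def)
  ultimately have sums: "(\<lambda>k. fps_nth h k * w ^ k * I k) sums
      integral {-pi..pi} (\<lambda>t. eval_fps h (w * cis t) * (B t * (cis t * of_real (sin t))))"
    by (simp add: I_def)
  have Ib: "cmod (I k) \<le> pi * C / sqrt (real n)" for k
    unfolding I_def C_def by (rule blaschke_wave_integral_bound[OF r n])
  have le: "cmod (fps_nth h k * w ^ k * I k) \<le> cmod (fps_nth h k) * (pi * C / sqrt (real n))" for
      k
    using mult_left_mono[OF Ib[of k], of "cmod (fps_nth h k)"] w1
      by (simp add: norm_mult norm_power)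
  have "2 * pi * cmod (fps_nth g 0)
      = cmod (w ^ n * integral {-pi..pi} (\<lambda>t. eval_fps G (w * cis t)))"
    unfolding intG using w1 by (simp add: norm_mult norm_power)
  also have "w ^ n * integral {-pi..pi} (\<lambda>t. eval_fps G (w * cis t)) =
      integral {-pi..pi} (\<lambda>t. eval_fps h (w * cis t) * (B t * (cis t * of_real (sin t)))) *
          (- 2 * \<i>)"
    unfolding integral_mult_right[symmetric] integral_mult_left[symmetric] id[symmetric]
    by (simp add: mult_ac)
  also have "cmod \<dots> = 2 * cmod (\<Sum>k. fps_nth h k * w ^ k * I k)"
    using sums by (simp add: norm_mult sums_iff)
  also have "cmod (\<Sum>k. fps_nth h k * w ^ k * I k)
      \<le> (\<Sum>k. cmod (fps_nth h k) * (pi * C / sqrt (real n)))"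
    by (rule norm_suminf_le[OF le]) (intro summable_mult2 wiener_summable hW)
  also have "\<dots> = wiener_norm h * (pi * C / sqrt (real n))"
    unfolding wiener_norm_def by (rule suminf_mult2[symmetric], rule wiener_summable[OF hW])
  finally have "2 * pi * cmod (fps_nth g 0) \<le> 2 * (wiener_norm h * (pi * C / sqrt (real n)))"
      by simp
  then have "2 * pi * cmod (fps_nth g 0) \<le> 2 * pi * (C * wiener_norm h / sqrt (real n))"
    by (simp add: mult_ac)
  then have "cmod (fps_nth g 0) \<le> C * wiener_norm h / sqrt (real n)"
    by (subst (asm) mult_le_cancel_left_pos) auto
  then show ?thesis using n unfolding C_def h_def r_def by (simp add: pos_le_divide_eq)
qed

section \<open>The extremal problem\<close>

lemma wiener_split:
  assumes "h \<in> wiener"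
  obtains q where "q \<in> wiener" "h = fps_const (fps_nth h 0) + fps_X * q"
proof
  show "fps_shift 1 h \<in> wiener"
    using assms by (simp add: wiener_def summable_Suc_iff[of "\<lambda>k. cmod (fps_nth h k)"])
  show "h = fps_const (fps_nth h 0) + fps_X * fps_shift 1 h"
    by (rule fps_ext) (simp add: fps_X_mult_nth)
qed

lemma wiener_phi_replicate:
  assumes l: "cmod l < 1" and n: "n \<ge> 1"
  shows "wiener_phi (replicate n l) = Inf {wiener_norm h - cmod (fps_nth h 0) | h.
    h \<in> wiener \<and> fps_nth h 0 = l ^ n \<and> (\<forall>j<n. taylor_coeff l j h = 0)}"
proof -
  have count: "count_list (replicate m l) l = m" for m by (induction m) auto
  have "(\<forall>x\<in>set (replicate n l). zero_of_order_ge (eval_fps h) x (count_list (replicate n l) x)) \<longleftrightarrow>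
      (\<forall>j<n. taylor_coeff l j h = 0)" if "h \<in> wiener" for h
    using n by (auto simp: zero_of_order_ge_iff[OF that l] count)
  then show ?thesis unfolding wiener_phi_def eval_fps_at_0 prod_list_replicate
    by (intro arg_cong[where f = Inf]) blast
qed

lemma wiener_phi_le:
  assumes l: "cmod l < 1" and n: "n \<ge> 1"
    and h: "h \<in> wiener" "fps_nth h 0 = l ^ n" "\<forall>j<n. taylor_coeff l j h = 0"
  shows "wiener_phi (replicate n l) \<le> wiener_norm h - cmod (fps_nth h 0)"
  unfolding wiener_phi_replicate[OF l n]
proof (rule cInf_lower)
  have "0 \<le> wiener_norm f - cmod (fps_nth f 0)" if "f \<in> wiener" for f
    using wiener_eval_bound[OF that, of 0] by (simp add: eval_fps_at_0)
  then show "bdd_below {wiener_norm h - cmod (fps_nth h 0) | h.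
      h \<in> wiener \<and> fps_nth h 0 = l ^ n \<and> (\<forall>j<n. taylor_coeff l j h = 0)}"
    by (intro bdd_belowI[where m = 0]) force
qed (use h in blast)

lemma taylor_coeff_linear_power_mult:
  assumes l: "cmod l < 1" and g: "g \<in> wiener"
  shows "j < n \<Longrightarrow> taylor_coeff l j ((fps_X - fps_const l) ^ n * g) = 0"
proof (induction n arbitrary: j)
  case (Suc n)
  have "(fps_X - fps_const l) ^ n * g \<in> wiener"
    by (intro wiener_mult wiener_power wiener_diff wiener_X wiener_const g)
  from taylor_coeff_linear_mult[OF this l, of j] Suc show ?case by (auto simp: mult.assoc)
qed auto

lemma le_wiener_phi:
  assumes l: "cmod l < 1" and n: "n \<ge> 1"
    and le: "\<And>h. h \<in> wiener \<Longrightarrow> fps_nth h 0 = l ^ n \<Longrightarrow> \<forall>j<n. taylor_coeff l j h = 0 \<Longrightarrow>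
      c \<le> wiener_norm h - cmod (fps_nth h 0)"
  shows "c \<le> wiener_phi (replicate n l)"
  unfolding wiener_phi_replicate[OF l n]
proof (rule cInf_greatest)
  let ?h = "(fps_X - fps_const l) ^ n * fps_const ((- 1) ^ n)"
  have "?h \<in> wiener" by (intro wiener_mult wiener_power wiener_diff wiener_X wiener_const)
  moreover have "fps_nth ?h 0 = l ^ n"
    by (simp add: fps_nth_power_0 flip: power_mult_distrib)
  moreover have "\<forall>j<n. taylor_coeff l j ?h = 0"
    by (auto intro!: taylor_coeff_linear_power_mult l wiener_const)
  ultimately show "{wiener_norm h - cmod (fps_nth h 0) | h.
      h \<in> wiener \<and> fps_nth h 0 = l ^ n \<and> (\<forall>j<n. taylor_coeff l j h = 0)} \<noteq> {}" by blast
qed (use le in auto)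

text \<open>
  The pairing argument bounds the full norm \<open>\<parallel>h\<parallel>\<close> from below. The subtracted term \<open>\<bar>h(0)\<bar>\<close>
  costs at most a factor \<open>2\<close>, since \<open>h(l) = 0\<close> gives \<open>\<bar>h(0)\<bar> \<le> \<parallel>h\<parallel> - \<bar>h(0)\<bar>\<close>.
\<close>
lemma wiener_phi_lower_bound:
  assumes l: "l \<noteq> 0" "cmod l < 1" and n: "n \<ge> 1"
  shows "sqrt (real n) / (2 * (3 + 2 * wave_const (cmod l))) \<le> wiener_phi (replicate n l)"
proof (rule le_wiener_phi[OF l(2) n])
  fix h assume h: "h \<in> wiener" "fps_nth h 0 = l ^ n" and zero: "\<forall>j<n. taylor_coeff l j h = 0"
  define C where "C = 3 + 2 * wave_const (cmod l)"
  have C: "C > 0" using wave_const_pos[of "cmod l"] l by (simp add: C_def)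
  obtain g where g: "g \<in> wiener" "h = (fps_X - fps_const l) ^ n * g"
    using zero_of_order_factor[OF l(2) h(1) zero] by blast
  have "fps_nth h 0 = (- l) ^ n * fps_nth g 0" by (simp add: g(2) fps_nth_power_0)
  then have "cmod l ^ n * cmod (fps_nth g 0) = cmod l ^ n"
    using h(2) by (metis norm_minus_cancel norm_mult norm_power)
  then have "cmod (fps_nth g 0) = 1" using l(1) by simp
  then have norm_h: "sqrt (real n) \<le> C * wiener_norm h"
    using wiener_norm_lower_bound[OF l n g(1)] g(2) by (simp add: C_def)
  obtain q where q: "q \<in> wiener" "h = fps_const (fps_nth h 0) + fps_X * q"
    using wiener_split[OF h(1)] by blast
  have split: "wiener_norm h = cmod (fps_nth h 0) + wiener_norm q"
    using wiener_const_mult_X_add(2)[OF q(1), of "fps_nth h 0"] q(2) by simp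
  have "eval_fps h l = 0" using zero n by (auto simp: taylor_coeff_def dest: spec[of _ 0])
  moreover have "fps_const (fps_nth h 0) = h - fps_X * q" using q(2) by (simp add: algebra_simps)
  ultimately have "fps_nth h 0 = - (l * eval_fps q l)"
    using wiener_eval_diff[OF h(1) wiener_X_mult(1)[OF q(1)], of l]
      wiener_eval_mult[OF wiener_X q(1), of l] l(2)
          by (metis diff_0 eval_fps_const eval_fps_X less_imp_le)
  then have "cmod (fps_nth h 0) \<le> wiener_norm q"
    using wiener_eval_bound[OF q(1), of l] l(2)
      mult_left_le_one_le[of "cmod (eval_fps q l)" "cmod l"]
    by (simp add: norm_mult)
  with split have "wiener_norm h \<le> 2 * (wiener_norm h - cmod (fps_nth h 0))" by simp
  from mult_left_mono[OF this, of C] norm_h C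
  have "sqrt (real n) \<le> C * (2 * (wiener_norm h - cmod (fps_nth h 0)))" by linarith
  also have "\<dots> = (wiener_norm h - cmod (fps_nth h 0)) * (2 * C)" by (simp only: mult_ac)
  finally have "sqrt (real n) \<le> (wiener_norm h - cmod (fps_nth h 0)) * (2 * C)" .
  then show "sqrt (real n) / (2 * (3 + 2 * wave_const (cmod l)))
      \<le> wiener_norm h - cmod (fps_nth h 0)"
    using C unfolding C_def[symmetric]
      by (simp only: pos_divide_le_eq mult_pos_pos zero_less_numeral)
qed

section \<open>Norms on complex vectors and induced norms\<close>

lemma
  assumes "is_norm_on n N"
  shows is_norm_on_nonneg: "v \<in> carrier_vec n \<Longrightarrow> 0 \<le> N v"
    and is_norm_on_eq_0_iff: "v \<in> carrier_vec n \<Longrightarrow> N v = 0 \<longleftrightarrow> v = 0\<^sub>v n"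
    and is_norm_on_smult: "v \<in> carrier_vec n \<Longrightarrow> N (a \<cdot>\<^sub>v v) = cmod a * N v"
    and is_norm_on_triangle: "u \<in> carrier_vec n \<Longrightarrow> v \<in> carrier_vec n \<Longrightarrow> N (u + v) \<le> N u + N v"
    and is_norm_on_zero: "N (0\<^sub>v n) = 0"
  using assms by (auto simp: is_norm_on_def)

lemma mult_mat_zero_vec: "A \<in> carrier_mat m n \<Longrightarrow> A *\<^sub>v 0\<^sub>v n = 0\<^sub>v m"
  by (intro eq_vecI) auto

lemma is_norm_on_diff:
  assumes N: "is_norm_on n N" and uv: "u \<in> carrier_vec n" "v \<in> carrier_vec n"
  shows "N (u - v) \<le> N u + N v"
proof -
  have "u - v = u + (- 1) \<cdot>\<^sub>v v" using uv by (intro eq_vecI) auto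
  then show ?thesis
    using is_norm_on_triangle[OF N, of u "(- 1) \<cdot>\<^sub>v v"] is_norm_on_smult[OF N, of v "- 1"] uv
      by simp
qed

lemma is_norm_on_le_coords:
  assumes N: "is_norm_on n N" and v: "v \<in> carrier_vec n"
  shows "N v \<le> (\<Sum>i<n. cmod (v $ i) * N (unit_vec n i))"
proof -
  define p where "p = (\<lambda>m. vec n (\<lambda>i. if i < m then v $ i else 0))"
  have "N (p m) \<le> (\<Sum>i<m. cmod (v $ i) * N (unit_vec n i))" if "m \<le> n" for m
    using that
  proof (induction m)
    case 0
    have "p 0 = 0\<^sub>v n" by (intro eq_vecI) (auto simp: p_def)
    then show ?case using is_norm_on_zero[OF N] by simp
  next
    case (Suc m)
    have "p (Suc m) = p m + v $ m \<cdot>\<^sub>v unit_vec n m"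
      using Suc.prems by (intro eq_vecI) (auto simp: p_def unit_vec_def less_Suc_eq)
    then have "N (p (Suc m)) \<le> N (p m) + cmod (v $ m) * N (unit_vec n m)"
      using is_norm_on_triangle[OF N, of "p m" "v $ m \<cdot>\<^sub>v unit_vec n m"]
        is_norm_on_smult[OF N, of "unit_vec n m"]
      by (simp add: p_def)
    then show ?case using Suc by simp
  qed
  moreover have "p n = v" using v by (intro eq_vecI) (auto simp: p_def)
  ultimately show ?thesis by force
qed

lemma is_norm_on_continuous:
  assumes N: "is_norm_on n N"
  shows "continuous_on UNIV (\<lambda>f :: nat \<Rightarrow> complex. N (vec n f))"
proof -
  have le: "\<bar>N (vec n g) - N (vec n f)\<bar> \<le> (\<Sum>i<n. cmod (g i - f i) * N (unit_vec n i))" for f g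
  proof -
    have *: "N (vec n g) - N (vec n f) \<le> (\<Sum>i<n. cmod (g i - f i) * N (unit_vec n i))" for f g
    proof -
      have "vec n g = vec n f + vec n (\<lambda>i. g i - f i)" by (intro eq_vecI) auto
      then have "N (vec n g) \<le> N (vec n f) + N (vec n (\<lambda>i. g i - f i))"
        using is_norm_on_triangle[OF N, of "vec n f" "vec n (\<lambda>i. g i - f i)"] by simp
      with is_norm_on_le_coords[OF N, of "vec n (\<lambda>i. g i - f i)"] show ?thesis by simp
    qed
    from *[of g f] *[of f g] show ?thesis by (simp add: norm_minus_commute)
  qed
  have "((\<lambda>g. N (vec n g)) \<longlongrightarrow> N (vec n f)) (at f)" for f :: "nat \<Rightarrow> complex"
  proof (rule LIM_zero_cancel, rule Lim_null_comparison)
    have "continuous_on UNIV (\<lambda>g :: nat \<Rightarrow> complex. \<Sum>i<n. cmod (g i - f i) * N (unit_vec n i))"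
      by (intro continuous_intros continuous_on_product_coordinates)
    then have "((\<lambda>g. \<Sum>i<n. cmod (g i - f i) * N (unit_vec n i)) \<longlongrightarrow> (\<Sum>i<n. cmod (f i - f i)
        * N (unit_vec n i))) (at f)"
      by (simp only: continuous_on_def) blast
    then show "((\<lambda>g. \<Sum>i<n. cmod (g i - f i) * N (unit_vec n i)) \<longlongrightarrow> 0) (at f)" by simp
  qed (use le in auto)
  then show ?thesis by (simp add: continuous_on_def)
qed

text \<open>
  All norms on \<open>\<complex>\<^sup>n\<close> are equivalent: a norm attains its minimum on the compact unit sphere of the
  \<open>\<ell>\<^sup>1\<close> norm. The sphere is realised among functions on \<open>nat\<close> that vanish from \<open>n\<close> on, a closed
  subset of a product of discs, to have a topology available for varying \<open>n\<close>. The bound is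
  what makes the supremum in \<open>induced_norm\<close> finite.
\<close>
lemma is_norm_on_ge_coords:
  assumes N: "is_norm_on n N"
  obtains c where "c > 0" "\<And>v. v \<in> carrier_vec n \<Longrightarrow> c * (\<Sum>i<n. cmod (v $ i)) \<le> N v"
proof -
  define box where "box = PiE UNIV (\<lambda>i. if i < n then cball 0 1 else {0 :: complex})"
  define S where "S = box \<inter> {f. (\<Sum>i<n. cmod (f i)) = 1}"
  have "compactin (product_topology (\<lambda>i :: nat. euclidean) UNIV) box"
    unfolding box_def compactin_PiE by auto
  then have "compact box" by (simp add: euclidean_product_topology)
  moreover have "closed {f :: nat \<Rightarrow> complex. (\<Sum>i<n. cmod (f i)) = 1}"
    by (intro closed_Collect_eq continuous_intros continuous_on_product_coordinates)
  ultimately have S: "compact S" unfolding S_def by (rule compact_Int_closed)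
  have scale: "\<exists>f\<in>S. N v = (\<Sum>i<n. cmod (v $ i)) * N (vec n f) \<and> (\<Sum>i<n. cmod (v $ i)) > 0"
    if v: "v \<in> carrier_vec n" and v0: "v \<noteq> 0\<^sub>v n" for v
  proof -
    define s where "s = (\<Sum>i<n. cmod (v $ i))"
    obtain i where i: "i < n" "v $ i \<noteq> 0" using v v0
        by (metis carrier_vecD eq_vecI index_zero_vec)
    have le: "cmod (v $ j) \<le> s" if "j < n" for j
      unfolding s_def by (rule member_le_sum) (use that in auto)
    with i have s: "s > 0" by (smt (verit) zero_less_norm_iff)
    define f where "f = (\<lambda>i. if i < n then v $ i / of_real s else 0)"
    have "(\<Sum>i<n. cmod (f i)) = (\<Sum>i<n. cmod (v $ i) / s)"
      using s by (intro sum.cong) (auto simp: f_def norm_divide)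
    also have "\<dots> = 1" using s by (simp add: s_def flip: sum_divide_distrib)
    finally have "f \<in> S" using le s by (auto simp: S_def box_def f_def norm_divide)
    moreover have "v = of_real s \<cdot>\<^sub>v vec n f" using v s by (intro eq_vecI) (auto simp: f_def)
    then have "N v = s * N (vec n f)" using is_norm_on_smult[OF N, of "vec n f" "of_real s"] s
        by simp
    ultimately show ?thesis using s unfolding s_def by blast
  qed
  show ?thesis
  proof (cases "S = {}")
    case True
    then have le: "(\<Sum>i<n. cmod (v $ i)) \<le> N v" if "v \<in> carrier_vec n" for v
      using scale[OF that] is_norm_on_zero[OF N] by fastforce
    show ?thesis by (rule that[of 1]) (use le in auto)
  next
    case False
    obtain f where f: "f \<in> S" "\<And>g. g \<in> S \<Longrightarrow> N (vec n f) \<le> N (vec n g)"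
      using continuous_attains_inf[OF S False
        continuous_on_subset[OF is_norm_on_continuous[OF N]]] by auto
    have "vec n f \<noteq> 0\<^sub>v n"
    proof
      assume "vec n f = 0\<^sub>v n"
      then have "f i = 0" if "i < n" for i using that by (metis index_vec index_zero_vec(1))
      then show False using f(1) by (simp add: S_def)
    qed
    then have pos: "N (vec n f) > 0"
      using is_norm_on_nonneg[OF N, of "vec n f"] is_norm_on_eq_0_iff[OF N, of "vec n f"] by simp
    show ?thesis
    proof (rule that[OF pos])
      fix v :: "complex vec" assume v: "v \<in> carrier_vec n"
      show "N (vec n f) * (\<Sum>i<n. cmod (v $ i)) \<le> N v"
      proof (cases "v = 0\<^sub>v n")
        case False
        from scale[OF v this] obtain g where "g \<in> S" "N v = (\<Sum>i<n. cmod (v $ i)) * N (vec n g)"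
           "(\<Sum>i<n. cmod (v $ i)) > 0" by blast
        then show ?thesis using f(2)[of g] by (simp add: mult.commute)
      qed (simp add: is_norm_on_zero[OF N])
    qed
  qed
qed

lemma matrix_bounded:
  assumes N: "is_norm_on n N" and A: "A \<in> carrier_mat n n"
  obtains K where "K \<ge> 0" "\<And>v. v \<in> carrier_vec n \<Longrightarrow> N (A *\<^sub>v v) \<le> K * N v"
proof -
  obtain c where c: "c > 0" "\<And>v. v \<in> carrier_vec n \<Longrightarrow> c * (\<Sum>i<n. cmod (v $ i)) \<le> N v"
    using is_norm_on_ge_coords[OF N] by metis
  define a where "a = (\<Sum>i<n. \<Sum>j<n. cmod (A $$ (i, j)))"
  define b where "b = (\<Sum>i<n. N (unit_vec n i))"
  have b0: "b \<ge> 0" unfolding b_def by (intro sum_nonneg is_norm_on_nonneg[OF N]) auto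
  have a0: "a \<ge> 0" unfolding a_def by (intro sum_nonneg) auto
  have le: "N (A *\<^sub>v v) \<le> a * b / c * N v" if v: "v \<in> carrier_vec n" for v
  proof -
    define s where "s = (\<Sum>i<n. cmod (v $ i))"
    have vs: "cmod (v $ j) \<le> s" if "j < n" for j
      unfolding s_def by (rule member_le_sum) (use that in auto)
    have s: "0 \<le> s" "s \<le> N v / c" using c(2)[OF v] c(1) unfolding s_def
      by (auto intro!: sum_nonneg simp: pos_le_divide_eq mult.commute)
    have "cmod ((A *\<^sub>v v) $ i) \<le> a * s" if i: "i < n" for i
    proof -
      have "(A *\<^sub>v v) $ i = (\<Sum>j<n. A $$ (i, j) * v $ j)"
        using i A v by (auto simp: scalar_prod_def atLeast0LessThan intro!: sum.cong)
      also have "cmod \<dots> \<le> (\<Sum>j<n. cmod (A $$ (i, j)) * s)"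
        by (rule order_trans[OF norm_sum])
            (auto intro!: sum_mono mult_left_mono vs simp: norm_mult)
      also have "\<dots> = (\<Sum>j<n. cmod (A $$ (i, j))) * s" by (simp add: sum_distrib_right)
      also have "\<dots> \<le> a * s"
        unfolding a_def by (intro mult_right_mono s(1)
            member_le_sum[of i "{..<n}" "\<lambda>i. \<Sum>j<n. cmod (A $$ (i, j))"])
          (use i in \<open>auto intro!: sum_nonneg\<close>)
      finally show ?thesis .
    qed
    moreover have "A *\<^sub>v v \<in> carrier_vec n" using A v by simp
    ultimately have "N (A *\<^sub>v v) \<le> (\<Sum>i<n. a * s * N (unit_vec n i))"
      by (intro order_trans[OF is_norm_on_le_coords[OF N]] sum_mono mult_right_mono
          is_norm_on_nonneg[OF N]) auto
    also have "\<dots> = a * b * s" by (simp add: b_def sum_distrib_left mult_ac)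
    also have "\<dots> \<le> a * b * (N v / c)" using a0 b0 s(2) by (intro mult_left_mono) auto
    finally show ?thesis by simp
  qed
  show ?thesis by (rule that[OF _ le]) (use a0 b0 c in auto)
qed

context
  fixes n :: nat and N :: "complex vec \<Rightarrow> real" and A :: "complex mat"
  assumes N: "is_norm_on n N" and A: "A \<in> carrier_mat n n"
begin

lemma induced_norm_bdd: "bdd_above {N (A *\<^sub>v v) | v. v \<in> carrier_vec n \<and> N v \<le> 1}"
proof -
  obtain K where K: "K \<ge> 0" "\<And>v. v \<in> carrier_vec n \<Longrightarrow> N (A *\<^sub>v v) \<le> K * N v"
    using matrix_bounded[OF N A] by metis
  have "N (A *\<^sub>v v) \<le> K" if "v \<in> carrier_vec n" "N v \<le> 1" for v
    using K(2)[OF that(1)] mult_left_mono[OF that(2) K(1)] by simp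
  then show ?thesis by (auto simp: bdd_above_def)
qed

lemma induced_norm_ge:
  assumes "v \<in> carrier_vec n" "N v \<le> 1"
  shows "N (A *\<^sub>v v) \<le> induced_norm n N A"
  unfolding induced_norm_def by (rule cSup_upper[OF _ induced_norm_bdd]) (use assms in auto)

lemma induced_norm_nonneg: "0 \<le> induced_norm n N A"
  using induced_norm_ge[of "0\<^sub>v n"] is_norm_on_zero[OF N]
    is_norm_on_nonneg[OF N, of "A *\<^sub>v 0\<^sub>v n"] A
  by simp

lemma induced_norm_mult_vec:
  assumes v: "v \<in> carrier_vec n"
  shows "N (A *\<^sub>v v) \<le> induced_norm n N A * N v"
proof (cases "v = 0\<^sub>v n")
  case True
  moreover have "A *\<^sub>v 0\<^sub>v n = 0\<^sub>v n" by (rule mult_mat_zero_vec[OF A])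
  ultimately show ?thesis using is_norm_on_zero[OF N] by simp
next
  case False
  then have pos: "N v > 0"
    using is_norm_on_nonneg[OF N v] is_norm_on_eq_0_iff[OF N v] by simp
  let ?u = "of_real (inverse (N v)) \<cdot>\<^sub>v v"
  have "N ?u \<le> 1" using pos is_norm_on_smult[OF N v] by (simp add: norm_inverse)
  then have "N (A *\<^sub>v ?u) \<le> induced_norm n N A" using v by (intro induced_norm_ge) auto
  also have "A *\<^sub>v ?u = of_real (inverse (N v)) \<cdot>\<^sub>v (A *\<^sub>v v)" by (rule mult_mat_vec[OF A v])
  also have "N \<dots> = N (A *\<^sub>v v) / N v"
    using pos A v is_norm_on_smult[OF N, of "A *\<^sub>v v"]
      by (simp add: norm_inverse divide_inverse mult.commute)
  finally show ?thesis using pos by (simp add: pos_divide_le_eq)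
qed

lemma induced_norm_le:
  assumes K: "K \<ge> 0" and le: "\<And>v. v \<in> carrier_vec n \<Longrightarrow> N (A *\<^sub>v v) \<le> K * N v"
  shows "induced_norm n N A \<le> K"
  unfolding induced_norm_def
proof (rule cSup_least)
  show "{N (A *\<^sub>v v) | v. v \<in> carrier_vec n \<and> N v \<le> 1} \<noteq> {}"
    using is_norm_on_zero[OF N] by (auto intro!: exI[of _ "0\<^sub>v n"])
next
  fix x assume "x \<in> {N (A *\<^sub>v v) | v. v \<in> carrier_vec n \<and> N v \<le> 1}"
  then obtain v where v: "x = N (A *\<^sub>v v)" "v \<in> carrier_vec n" "N v \<le> 1" by blast
  show "x \<le> K" using le[OF v(2)] mult_left_mono[OF v(3) K] v(1) by simp
qed

lemma eigenvalue_le_induced_norm: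
  assumes "eigenvalue A e"
  shows "cmod e \<le> induced_norm n N A"
proof -
  obtain v where v: "v \<in> carrier_vec n" "v \<noteq> 0\<^sub>v n" "A *\<^sub>v v = e \<cdot>\<^sub>v v"
    using assms A by (auto simp: eigenvalue_def eigenvector_def)
  have "cmod e * N v \<le> induced_norm n N A * N v"
    using induced_norm_mult_vec[OF v(1)] is_norm_on_smult[OF N v(1), of e] v(3) by simp
  moreover have "N v > 0"
    using is_norm_on_nonneg[OF N v(1)] is_norm_on_eq_0_iff[OF N v(1)] v(2) by simp
  ultimately show ?thesis by (simp add: mult_le_cancel_right_pos)
qed

end

section \<open>An admissible Schaeffer constant\<close>

text \<open>
  \<open>deflate T e k\<close> is \<open>(T - e\<^sub>0) \<cdots> (T - e\<^sub>k\<^sub>-\<^sub>1)\<close>, and \<open>deflate_quotient T e k\<close> is the operator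
  \<open>S\<close> in the division \<open>(T - e\<^sub>0) \<cdots> (T - e\<^sub>k\<^sub>-\<^sub>1) = \<Prod>(- e\<^sub>i) + T S\<close> of this polynomial
  in \<open>T\<close> by \<open>T\<close>. When the \<open>e\<^sub>i\<close> are the \<open>n\<close> eigenvalues and \<open>k = n\<close>, the left side vanishes and
  \<open>S = - \<Prod>(- e\<^sub>i) \<cdot> T\<^sup>-\<^sup>1\<close>, whose norm is that of \<open>det T \<cdot> T\<^sup>-\<^sup>1\<close>.
\<close>
fun deflate :: "complex mat \<Rightarrow> (nat \<Rightarrow> complex) \<Rightarrow> nat \<Rightarrow> complex vec \<Rightarrow> complex vec" where
  "deflate T e 0 v = v"
| "deflate T e (Suc k) v = deflate T e k (T *\<^sub>v v - e k \<cdot>\<^sub>v v)"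

fun deflate_quotient :: "complex mat \<Rightarrow> (nat \<Rightarrow> complex) \<Rightarrow> nat \<Rightarrow> complex vec \<Rightarrow> complex vec" where
  "deflate_quotient T e 0 v = 0\<^sub>v (dim_vec v)"
| "deflate_quotient T e (Suc k) v =
     (\<Prod>i<k. - e i) \<cdot>\<^sub>v v + deflate_quotient T e k (T *\<^sub>v v - e k \<cdot>\<^sub>v v)"

lemma deflate_quotient_carrier:
  "T \<in> carrier_mat n n \<Longrightarrow> v \<in> carrier_vec n \<Longrightarrow> deflate_quotient T e k v \<in> carrier_vec n"
  by (induction k arbitrary: v) auto

lemma deflate_eq:
  assumes T: "T \<in> carrier_mat n n" and v: "v \<in> carrier_vec n"
  shows "deflate T e k v = (\<Prod>i<k. - e i) \<cdot>\<^sub>v v + T *\<^sub>v deflate_quotient T e k v"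
  using v
proof (induction k arbitrary: v)
  case 0
  then show ?case using T by auto
next
  case (Suc k)
  let ?u = "T *\<^sub>v v - e k \<cdot>\<^sub>v v" and ?c = "\<Prod>i<k. - e i"
  have u: "?u \<in> carrier_vec n" using T Suc.prems by simp
  note r = deflate_quotient_carrier[OF T u, of e k]
  have Tv: "T *\<^sub>v v \<in> carrier_vec n" using T Suc.prems by simp
  have "T *\<^sub>v (?c \<cdot>\<^sub>v v + deflate_quotient T e k ?u)
      = ?c \<cdot>\<^sub>v (T *\<^sub>v v) + T *\<^sub>v deflate_quotient T e k ?u"
    using mult_add_distrib_mat_vec[OF T _ r, of "?c \<cdot>\<^sub>v v"] mult_mat_vec[OF T Suc.prems] Suc.prems
      by simp
  moreover have "?c \<cdot>\<^sub>v ?u + x = (?c * - e k) \<cdot>\<^sub>v v + (?c \<cdot>\<^sub>v (T *\<^sub>v v) + x)"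
      if "x \<in> carrier_vec n" for x
    using that Suc.prems Tv T by (intro eq_vecI)
      (auto simp: algebra_simps simp del: index_mult_mat_vec)
  ultimately show ?case using Suc.IH[OF u] T r by simp
qed

lemma deflate_similar:
  assumes PBQ: "P \<in> carrier_mat n n" "B \<in> carrier_mat n n" "Q \<in> carrier_mat n n"
    and inv: "Q * P = 1\<^sub>m n" "P * Q = 1\<^sub>m n" and v: "v \<in> carrier_vec n"
  shows "deflate (P * B * Q) e k v = P *\<^sub>v deflate B e k (Q *\<^sub>v v)"
  using v
proof (induction k arbitrary: v)
  case 0
  then show ?case using PBQ inv by (simp flip: assoc_mult_mat_vec[of _ n n _ n])
next
  case (Suc k)
  have T: "P * B * Q \<in> carrier_mat n n" using PBQ by simp
  then have Tv: "P * B * Q *\<^sub>v v \<in> carrier_vec n" using Suc.prems by simp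
  have "Q *\<^sub>v (P * B * Q *\<^sub>v v) = B *\<^sub>v (Q *\<^sub>v v)"
  proof -
    have "Q *\<^sub>v (P * B * Q *\<^sub>v v) = (Q * (P * B * Q)) *\<^sub>v v"
      using PBQ Suc.prems by (simp add: assoc_mult_mat_vec[of _ n n _ n])
    also have "Q * (P * B * Q) = (Q * P) * (B * Q)"
      using PBQ by (simp add: assoc_mult_mat[of _ n n _ n _ n])
    also have "\<dots> *\<^sub>v v = B *\<^sub>v (Q *\<^sub>v v)"
      using PBQ Suc.prems inv by (simp add: assoc_mult_mat_vec[of _ n n _ n])
    finally show ?thesis .
  qed
  moreover have "Q *\<^sub>v (P * B * Q *\<^sub>v v - e k \<cdot>\<^sub>v v)
      = Q *\<^sub>v (P * B * Q *\<^sub>v v) - e k \<cdot>\<^sub>v (Q *\<^sub>v v)"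
    using mult_minus_distrib_mat_vec[OF PBQ(3) Tv, of "e k \<cdot>\<^sub>v v"] Suc.prems
      mult_mat_vec[OF PBQ(3) Suc.prems, of "e k"] by simp
  ultimately show ?case using Suc.IH[of "P * B * Q *\<^sub>v v - e k \<cdot>\<^sub>v v"] T Suc.prems by simp
qed

text \<open>
  The Cayley-Hamilton theorem for triangular matrices: the factor \<open>B - B\<^sub>k\<^sub>k\<close> maps the span of the
  first \<open>k + 1\<close> basis vectors into the span of the first \<open>k\<close>.
\<close>
lemma deflate_upper_triangular:
  assumes B: "B \<in> carrier_mat n n" "upper_triangular B"
  shows "k \<le> n \<Longrightarrow> v \<in> carrier_vec n \<Longrightarrow> \<forall>i<n. k \<le> i \<longrightarrow> v $ i = 0 \<Longrightarrow>
    deflate B (\<lambda>i. B $$ (i, i)) k v = 0\<^sub>v n"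
proof (induction k arbitrary: v)
  case 0
  then show ?case by (auto intro!: eq_vecI)
next
  case (Suc k)
  let ?u = "B *\<^sub>v v - B $$ (k, k) \<cdot>\<^sub>v v"
  have "?u $ i = 0" if i: "i < n" "k \<le> i" for i
  proof -
    have "(B *\<^sub>v v) $ i = (\<Sum>j<n. B $$ (i, j) * v $ j)"
      using i B Suc.prems by (auto simp: scalar_prod_def atLeast0LessThan intro!: sum.cong)
    also have "\<dots> = (\<Sum>j<n. if j = k then B $$ (i, k) * v $ k else 0)"
    proof (rule sum.cong)
      fix j assume "j \<in> {..<n}"
      then show "B $$ (i, j) * v $ j = (if j = k then B $$ (i, k) * v $ k else 0)"
        using Suc.prems(3) B i upper_triangularD[OF B(2), of j i] by (cases "j < k") auto
    qed simp
    also have "\<dots> = B $$ (i, k) * v $ k" using Suc.prems(1) by simp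
    finally have "?u $ i = B $$ (i, k) * v $ k - B $$ (k, k) * v $ i" using i B Suc.prems by simp
    then show ?thesis using i Suc.prems upper_triangularD[OF B(2), of k i] B
        by (cases "i = k") auto
  qed
  then show ?case using Suc B by auto
qed

text \<open>
  With \<open>t\<close> the norm of \<open>T\<close>, every factor \<open>T - e\<^sub>i\<close> has norm at most \<open>2 t\<close>, so the bounds
  \<open>\<rho>\<^sub>k\<close> of the quotients satisfy \<open>\<rho>\<^sub>k\<^sub>+\<^sub>1 = t ^ k + 2 t \<rho>\<^sub>k\<close> with \<open>\<rho>\<^sub>0 = 0\<close>, which
  \<open>(2 ^ k - 1) t ^ (k - 1)\<close> solves.
\<close>
lemma deflate_quotient_bound:
  assumes N: "is_norm_on n N" and T: "T \<in> carrier_mat n n"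
    and e: "\<And>i. i < k \<Longrightarrow> cmod (e i) \<le> induced_norm n N T" and v: "v \<in> carrier_vec n"
  shows "N (deflate_quotient T e k v) \<le> (2 ^ k - 1) * induced_norm n N T ^ (k - 1) * N v"
  using e v
proof (induction k arbitrary: v)
  case 0
  then show ?case using is_norm_on_zero[OF N] by auto
next
  case (Suc k)
  define t where "t = induced_norm n N T"
  let ?u = "T *\<^sub>v v - e k \<cdot>\<^sub>v v" and ?c = "\<Prod>i<k. - e i"
  have t: "t \<ge> 0" unfolding t_def by (rule induced_norm_nonneg[OF N T])
  have Nv: "N v \<ge> 0" by (rule is_norm_on_nonneg[OF N Suc.prems(2)])
  have u: "?u \<in> carrier_vec n" using T Suc.prems by simp
  note r = deflate_quotient_carrier[OF T u, of e k]
  have Nu: "N ?u \<le> 2 * t * N v"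
  proof -
    have "N ?u \<le> N (T *\<^sub>v v) + N (e k \<cdot>\<^sub>v v)" using T Suc.prems
        by (intro is_norm_on_diff[OF N]) auto
    also have "\<dots> \<le> t * N v + t * N v"
      using induced_norm_mult_vec[OF N T Suc.prems(2)] is_norm_on_smult[OF N Suc.prems(2)]
        mult_right_mono[OF Suc.prems(1)[of k] Nv] unfolding t_def by (simp add: mult.commute)
    finally show ?thesis by simp
  qed
  have c: "cmod ?c \<le> t ^ k"
    using prod_mono[of "{..<k}" "\<lambda>i. cmod (- e i)" "\<lambda>i. t"] Suc.prems(1)
    by (auto simp: t_def simp flip: prod_norm)
  have "N (deflate_quotient T e (Suc k) v) \<le> N (?c \<cdot>\<^sub>v v) + N (deflate_quotient T e k ?u)"
    using is_norm_on_triangle[OF N _ r, of "?c \<cdot>\<^sub>v v"] Suc.prems by simp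
  also have "N (?c \<cdot>\<^sub>v v) \<le> t ^ k * N v"
    using is_norm_on_smult[OF N Suc.prems(2)] mult_right_mono[OF c Nv] by simp
  also have "N (deflate_quotient T e k ?u) \<le> (2 ^ k - 1) * t ^ (k - 1) * N ?u"
    unfolding t_def by (rule Suc.IH[OF _ u]) (use Suc.prems in auto)
  also have "\<dots> \<le> (2 ^ k - 1) * t ^ (k - 1) * (2 * t * N v)"
    using t by (intro mult_left_mono Nu mult_nonneg_nonneg) auto
  also have "(2 ^ k - 1) * t ^ (k - 1) * (2 * t * N v) = (2 * 2 ^ k - 2) * t ^ k * N v"
    by (cases k) (auto simp: algebra_simps)
  finally show ?case by (simp add: t_def algebra_simps)
qed

text \<open>
  A Schur decomposition reduces the Cayley-Hamilton theorem for \<open>T\<close> to the triangular case, and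
  eigenvalues are bounded by every induced norm.
\<close>
lemma schaeffer_bound_exists: "schaeffer_bound n (2 ^ n)"
  unfolding schaeffer_bound_def
proof (intro allI impI, elim conjE)
  fix N :: "complex vec \<Rightarrow> real" and T R :: "complex mat"
  assume N: "is_norm_on n N" and T: "T \<in> carrier_mat n n" and R: "R \<in> carrier_mat n n"
    and inv: "inverts_mat T R" "inverts_mat R T"
  define t where "t = induced_norm n N T"
  obtain es where es: "char_poly T = (\<Prod>a\<leftarrow>es. [:- a, 1:])" using char_poly_factorized[OF T]
      by blast
  obtain B P Q where schur: "schur_decomposition T es = (B, P, Q)"
      by (cases "schur_decomposition T es") auto
  from schur_decomposition[OF T es schur]
  have sim: "similar_mat_wit T B P Q" and ut: "upper_triangular B" and diag: "diag_mat B = es"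
      by auto
  note w = similar_mat_witD2[OF T sim]
  define e where "e = (\<lambda>i. B $$ (i, i))"
  define c where "c = (\<Prod>i<n. - e i)"
  have t: "t \<ge> 0" unfolding t_def by (rule induced_norm_nonneg[OF N T])
  have e: "cmod (e i) \<le> t" if "i < n" for i
  proof -
    have "e i \<in> set es" using that w(5) unfolding diag[symmetric]
        by (auto simp: diag_mat_def e_def)
    then have "poly (char_poly T) (e i) = 0" unfolding es
        by (auto simp: poly_prod_list prod_list_zero_iff)
    then show ?thesis unfolding t_def
      using eigenvalue_root_char_poly[OF T] by (intro eigenvalue_le_induced_norm[OF N T]) auto
  qed
  have det: "cmod (det T) = cmod c"
  proof -
    have "det T = det B" by (rule det_similar) (use sim in \<open>auto simp: similar_mat_def\<close>)
    also have "\<dots> = prod_list (diag_mat B)" by (rule det_upper_triangular[OF ut w(5)])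
    also have "\<dots> = (\<Prod>i<n. e i)"
      using w(5) by (simp add: diag_mat_def e_def prod.distinct_set_conv_list[symmetric]
        atLeast0LessThan)
    finally show ?thesis by (simp add: c_def flip: prod_norm)
  qed
  have le: "cmod c * N (R *\<^sub>v v) \<le> 2 ^ n * t ^ (n - 1) * N v" if v: "v \<in> carrier_vec n" for v
  proof -
    let ?r = "deflate_quotient T e n v"
    have r: "?r \<in> carrier_vec n" by (rule deflate_quotient_carrier[OF T v])
    have "deflate T e n v = P *\<^sub>v deflate B e n (Q *\<^sub>v v)"
      using deflate_similar[OF w(6,5,7) w(2,1) v] w(3) by simp
    also have "deflate B e n (Q *\<^sub>v v) = 0\<^sub>v n"
      unfolding e_def by (rule deflate_upper_triangular[OF w(5) ut]) (use w v in auto)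
    finally have "c \<cdot>\<^sub>v v + T *\<^sub>v ?r = 0\<^sub>v n"
      using deflate_eq[OF T v, of e n] mult_mat_zero_vec[OF w(6)] by (simp add: c_def)
    then have "R *\<^sub>v (c \<cdot>\<^sub>v v + T *\<^sub>v ?r) = 0\<^sub>v n" using mult_mat_zero_vec[OF R] by simp
    also have "R *\<^sub>v (c \<cdot>\<^sub>v v + T *\<^sub>v ?r) = c \<cdot>\<^sub>v (R *\<^sub>v v) + R *\<^sub>v (T *\<^sub>v ?r)"
      using mult_add_distrib_mat_vec[OF R, of "c \<cdot>\<^sub>v v" "T *\<^sub>v ?r"] mult_mat_vec[OF R v] v r T
        by simp
    also have "R *\<^sub>v (T *\<^sub>v ?r) = ?r"
      using inv(2) R T r by (simp add: inverts_mat_def flip: assoc_mult_mat_vec[of _ n n _ n])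
    finally have "c \<cdot>\<^sub>v (R *\<^sub>v v) + ?r = 0\<^sub>v n" .
    then have "?r = (- c) \<cdot>\<^sub>v (R *\<^sub>v v)"
      using R v r by (intro eq_vecI)
        (auto simp: vec_eq_iff eq_neg_iff_add_eq_0 add.commute simp del: index_mult_mat_vec)
    then have "cmod c * N (R *\<^sub>v v) = N ?r"
      using is_norm_on_smult[OF N, of "R *\<^sub>v v" "- c"] R v by simp
    also have "\<dots> \<le> (2 ^ n - 1) * t ^ (n - 1) * N v"
      unfolding t_def by (rule deflate_quotient_bound[OF N T _ v]) (use e t_def in auto)
    also have "\<dots> \<le> 2 ^ n * t ^ (n - 1) * N v"
      using t is_norm_on_nonneg[OF N v] by (intro mult_right_mono) auto
    finally show ?thesis .
  qed
  show "cmod (det T) * induced_norm n N R \<le> 2 ^ n * induced_norm n N T ^ (n - 1)"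
  proof (cases "c = 0")
    case True
    then show ?thesis using det t by (simp add: t_def)
  next
    case False
    have "induced_norm n N R \<le> 2 ^ n * t ^ (n - 1) / cmod c"
    proof (rule induced_norm_le[OF N R])
      show "N (R *\<^sub>v v) \<le> 2 ^ n * t ^ (n - 1) / cmod c * N v" if "v \<in> carrier_vec n" for v
        using le[OF that] False by (simp add: field_simps)
    qed (use t in auto)
    then show ?thesis using False by (simp add: det t_def field_simps)
  qed
qed

section \<open>The quotient of the Wiener algebra by an ideal\<close>

definition quotient_norm :: "nat \<Rightarrow> complex \<Rightarrow> complex vec \<Rightarrow> real" where
  "quotient_norm n l v = Inf {wiener_norm h | h. h \<in> wiener \<and> (\<forall>j<n. taylor_coeff l j h = v $ j)}"

lemma quotient_norm_le:
  assumes "h \<in> wiener" "\<forall>j<n. taylor_coeff l j h = v $ j"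
  shows "quotient_norm n l v \<le> wiener_norm h"
  unfolding quotient_norm_def
  by (rule cInf_lower) (use assms wiener_norm_nonneg in \<open>auto simp: bdd_below_def\<close>)

lemma le_quotient_norm:
  assumes l: "cmod l < 1"
    and "\<And>h. h \<in> wiener \<Longrightarrow> \<forall>j<n. taylor_coeff l j h = v $ j \<Longrightarrow> c \<le> wiener_norm h"
  shows "c \<le> quotient_norm n l v"
  unfolding quotient_norm_def
  by (rule cInf_greatest) (use assms(2) taylor_coeff_surj[OF l, of n "\<lambda>j. v $ j"] in auto)

lemma is_norm_on_quotient_norm:
  assumes l: "cmod l < 1"
  shows "is_norm_on n (quotient_norm n l)"
proof -
  let ?N = "quotient_norm n l"
  have nonneg: "0 \<le> ?N v" for v by (rule le_quotient_norm[OF l]) (rule wiener_norm_nonneg)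
  have zero: "?N (0\<^sub>v n) = 0"
    using quotient_norm_le[of 0 n l "0\<^sub>v n"] nonneg[of "0\<^sub>v n"] wiener_0
      taylor_coeff_const[OF l, of _ 0]
    by simp
  have definite: "v = 0\<^sub>v n" if v: "v \<in> carrier_vec n" and v0: "?N v = 0" for v
  proof (rule eq_vecI)
    fix j assume "j < dim_vec (0\<^sub>v n :: complex vec)"
    then have j: "j < n" by simp
    define r where "r = ((1 - cmod l) / 2) ^ j"
    have r: "r > 0" using l by (simp add: r_def)
    have "cmod (v $ j) * r \<le> ?N v"
    proof (rule le_quotient_norm[OF l])
      fix h assume "h \<in> wiener" "\<forall>j<n. taylor_coeff l j h = v $ j"
      then show "cmod (v $ j) * r \<le> wiener_norm h"
        using taylor_coeff_bound[of h l j] l j r by (simp add: r_def pos_le_divide_eq)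
    qed
    then have "cmod (v $ j) \<le> 0" using v0 r by (simp add: mult_le_0_iff)
    then show "v $ j = 0\<^sub>v n $ j" using j by simp
  qed (use v in simp)
  have smult_le: "?N (a \<cdot>\<^sub>v v) \<le> cmod a * ?N v" if v: "v \<in> carrier_vec n" for a v
  proof (cases "a = 0")
    case True
    then have "a \<cdot>\<^sub>v v = 0\<^sub>v n" using v by (intro eq_vecI) auto
    then show ?thesis using zero True by simp
  next
    case False
    have "?N (a \<cdot>\<^sub>v v) / cmod a \<le> ?N v"
    proof (rule le_quotient_norm[OF l])
      fix h assume h: "h \<in> wiener" "\<forall>j<n. taylor_coeff l j h = v $ j"
      have "?N (a \<cdot>\<^sub>v v) \<le> wiener_norm (fps_const a * h)"
        by (rule quotient_norm_le)
            (use h v l in \<open>auto intro: wiener_mult wiener_const simp: taylor_coeff_cmult\<close>)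
      then show "?N (a \<cdot>\<^sub>v v) / cmod a \<le> wiener_norm h"
        unfolding wiener_const_mult[OF h(1)] using False
            by (simp add: pos_divide_le_eq mult.commute)
    qed
    then show ?thesis using False by (simp add: pos_divide_le_eq mult.commute)
  qed
  have smult: "?N (a \<cdot>\<^sub>v v) = cmod a * ?N v" if v: "v \<in> carrier_vec n" for a v
  proof (cases "a = 0")
    case True
    then show ?thesis using smult_le[OF v, of a] nonneg[of "a \<cdot>\<^sub>v v"] by simp
  next
    case False
    then have "inverse a \<cdot>\<^sub>v (a \<cdot>\<^sub>v v) = v" by (simp add: smult_smult_assoc)
    then have "?N v \<le> ?N (a \<cdot>\<^sub>v v) / cmod a"
      using smult_le[of "a \<cdot>\<^sub>v v" "inverse a"] v
        by (simp add: norm_inverse divide_inverse mult.commute)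
    then have "cmod a * ?N v \<le> ?N (a \<cdot>\<^sub>v v)" using False
        by (simp add: pos_le_divide_eq mult.commute)
    with smult_le[OF v, of a] show ?thesis by simp
  qed
  have triangle: "?N (u + v) \<le> ?N u + ?N v" if uv: "u \<in> carrier_vec n" "v \<in> carrier_vec n" for u v
  proof -
    have "?N (u + v) - ?N u \<le> ?N v"
    proof (rule le_quotient_norm[OF l])
      fix g assume g: "g \<in> wiener" "\<forall>j<n. taylor_coeff l j g = v $ j"
      have "?N (u + v) - wiener_norm g \<le> ?N u"
      proof (rule le_quotient_norm[OF l])
        fix f assume f: "f \<in> wiener" "\<forall>j<n. taylor_coeff l j f = u $ j"
        have "?N (u + v) \<le> wiener_norm (f + g)"
          by (rule quotient_norm_le) (use f g uv l in \<open>auto simp: wiener_add taylor_coeff_add\<close>)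
        with wiener_add(2)[OF f(1) g(1)] show "?N (u + v) - wiener_norm g \<le> wiener_norm f" by simp
      qed
      then show "?N (u + v) - ?N u \<le> wiener_norm g" by simp
    qed
    then show ?thesis by simp
  qed
  show ?thesis unfolding is_norm_on_def using nonneg zero definite smult triangle by blast
qed

text \<open>Multiplication by \<open>z\<close> in the Taylor coordinates at \<open>l\<close>.\<close>
definition shift_mat :: "nat \<Rightarrow> complex \<Rightarrow> complex mat" where
  "shift_mat n l = mat n n (\<lambda>(i, j). if i = j then l else if i = Suc j then 1 else 0)"

lemma shift_mat_carrier: "shift_mat n l \<in> carrier_mat n n"
  by (simp add: shift_mat_def)

lemma shift_mat_mult_vec:
  assumes v: "v \<in> carrier_vec n" and i: "i < n"
  shows "(shift_mat n l *\<^sub>v v) $ i = l * v $ i + (if i = 0 then 0 else v $ (i - 1))"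
proof -
  have "(shift_mat n l *\<^sub>v v) $ i
      = (\<Sum>j<n. (if i = j then l else if i = Suc j then 1 else 0) * v $ j)"
    using i v by (auto simp: shift_mat_def scalar_prod_def atLeast0LessThan intro!: sum.cong)
  also have "\<dots> = (\<Sum>j<n. (if j = i then l * v $ i else 0)
      + (if j = i - 1 then if i = 0 then 0 else v $ (i - 1) else 0))"
    by (intro sum.cong) auto
  also have "\<dots> = l * v $ i + (if i = 0 then 0 else v $ (i - 1))"
    using i by (simp add: sum.distrib)
  finally show ?thesis .
qed

lemma taylor_coeff_X_mult_shift_mat:
  assumes l: "cmod l < 1" and v: "v \<in> carrier_vec n"
    and h: "h \<in> wiener" "\<forall>j<n. taylor_coeff l j h = v $ j" and j: "j < n"
  shows "taylor_coeff l j (fps_X * h) = (shift_mat n l *\<^sub>v v) $ j"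
  using h j by (simp add: taylor_coeff_X_mult[OF h(1) l] shift_mat_mult_vec[OF v j])

lemma det_shift_mat: "det (shift_mat n l) = l ^ n"
proof -
  have "det (shift_mat n l) = prod_list (diag_mat (shift_mat n l))"
    by (rule det_lower_triangular[OF _ shift_mat_carrier]) (simp add: shift_mat_def)
  also have "diag_mat (shift_mat n l) = replicate n l"
    by (intro nth_equalityI) (auto simp: diag_mat_def shift_mat_def)
  finally show ?thesis by simp
qed

lemma induced_norm_shift_mat:
  assumes l: "cmod l < 1"
  shows "induced_norm n (quotient_norm n l) (shift_mat n l) \<le> 1"
proof (rule induced_norm_le[OF is_norm_on_quotient_norm[OF l] shift_mat_carrier])
  fix v :: "complex vec" assume v: "v \<in> carrier_vec n"
  show "quotient_norm n l (shift_mat n l *\<^sub>v v) \<le> 1 * quotient_norm n l v"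
    unfolding mult_1
  proof (rule le_quotient_norm[OF l])
    fix h assume h: "h \<in> wiener" "\<forall>j<n. taylor_coeff l j h = v $ j"
    have "quotient_norm n l (shift_mat n l *\<^sub>v v) \<le> wiener_norm (fps_X * h)"
      using taylor_coeff_X_mult_shift_mat[OF l v h] wiener_X_mult(1)[OF h(1)]
      by (intro quotient_norm_le) auto
    then show "quotient_norm n l (shift_mat n l *\<^sub>v v) \<le> wiener_norm h"
      by (simp add: wiener_X_mult(2)[OF h(1)])
  qed
qed simp

text \<open>
  The admissible constant \<open>s\<close> is tested on multiplication by \<open>z\<close> in the quotient and on the class
  of \<open>1\<close>. Since the norm of this operator is at most \<open>1\<close>, its power can be dropped from the bound once
  \<open>s \<ge> 0\<close> is known; this follows as \<open>wiener_phi\<close> is positive.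
\<close>
lemma wiener_phi_le_schaeffer_bound:
  assumes l: "l \<noteq> 0" "cmod l < 1" and n: "n \<ge> 1" and s: "schaeffer_bound n s"
  shows "wiener_phi (replicate n l) \<le> s"
proof -
  let ?N = "quotient_norm n l" and ?T = "shift_mat n l" and ?e = "unit_vec n 0 :: complex vec"
  note N = is_norm_on_quotient_norm[OF l(2), of n] and T = shift_mat_carrier[of n l]
  obtain R where R: "R \<in> carrier_mat n n" "?T * R = 1\<^sub>m n" "R * ?T = 1\<^sub>m n"
    using det_non_zero_imp_unit[OF T, of undefined] l(1) det_shift_mat[of n l]
    unfolding Units_def ring_mat_def by auto
  define v where "v = l ^ n \<cdot>\<^sub>v (R *\<^sub>v ?e)"
  have v: "v \<in> carrier_vec n" using R by (simp add: v_def)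
  have "?T *\<^sub>v (R *\<^sub>v ?e) = ?e"
    using R(1,2) T by (simp flip: assoc_mult_mat_vec[of _ n n _ n])
  then have Tv: "?T *\<^sub>v v = l ^ n \<cdot>\<^sub>v ?e"
    unfolding v_def using mult_mat_vec[OF T, of "R *\<^sub>v ?e" "l ^ n"] R(1) by simp
  have "wiener_phi (replicate n l) \<le> ?N v"
  proof (rule le_quotient_norm[OF l(2)])
    fix g assume g: "g \<in> wiener" "\<forall>j<n. taylor_coeff l j g = v $ j"
    \<comment> \<open>\<open>h = l ^ n - z g\<close> is in the ideal because \<open>T v = l ^ n [1]\<close> and \<open>g\<close> represents \<open>v\<close>.\<close>
    define f where "f = fps_const (- 1) * g"
    have f: "f \<in> wiener" unfolding f_def by (intro wiener_mult wiener_const g)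
    have Xf: "fps_X * f = fps_const (- 1) * (fps_X * g)" by (simp add: f_def mult_ac)
    let ?h = "fps_const (l ^ n) + fps_X * f"
    have "taylor_coeff l j ?h = 0" if j: "j < n" for j
    proof -
      have "taylor_coeff l j ?h = taylor_coeff l j (fps_const (l ^ n))
          + taylor_coeff l j (fps_X * f)"
        by (intro taylor_coeff_add wiener_const wiener_X_mult f l)
      also have "taylor_coeff l j (fps_X * f) = - ((?T *\<^sub>v v) $ j)"
        unfolding Xf using taylor_coeff_X_mult_shift_mat[OF l(2) v g j]
        by (subst taylor_coeff_cmult) (auto intro: wiener_X_mult g l)
      finally show ?thesis using j by (simp add: Tv taylor_coeff_const[OF l(2)])
    qed
    then have "wiener_phi (replicate n l) \<le> wiener_norm ?h - cmod (fps_nth ?h 0)"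
      by (intro wiener_phi_le[OF l(2) n] wiener_const_mult_X_add f) auto
    also have "\<dots> = wiener_norm g"
      using wiener_const_mult_X_add(2)[OF f, of "l ^ n"] wiener_const_mult[OF g(1), of "- 1"]
      by (simp add: f_def)
    finally show "wiener_phi (replicate n l) \<le> wiener_norm g" .
  qed
  also have "?N v = cmod (det ?T) * ?N (R *\<^sub>v ?e)"
    unfolding v_def det_shift_mat using R(1) by (intro is_norm_on_smult[OF N]) auto
  also have "?N (R *\<^sub>v ?e) \<le> induced_norm n ?N R"
  proof (rule induced_norm_ge[OF N R(1)])
    show "?N ?e \<le> 1"
      using quotient_norm_le[of "fps_const 1" n l ?e] wiener_const[of 1] n
      by (simp add: taylor_coeff_const[OF l(2)] del: fps_const_1_eq_1)
  qed simp
  also have "cmod (det ?T) * induced_norm n ?N R \<le> s * induced_norm n ?N ?T ^ (n - 1)"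
    using s N T R unfolding schaeffer_bound_def inverts_mat_def by auto
  finally have le: "wiener_phi (replicate n l) \<le> s * induced_norm n ?N ?T ^ (n - 1)"
    by (simp add: mult_left_mono)
  have "0 < sqrt (real n) / (2 * (3 + 2 * wave_const (cmod l)))"
    using n l wave_const_pos[of "cmod l"] by simp
  also have "\<dots> \<le> wiener_phi (replicate n l)" by (rule wiener_phi_lower_bound[OF l n])
  finally have "0 < s * induced_norm n ?N ?T ^ (n - 1)" using le by simp
  moreover have T1: "0 \<le> induced_norm n ?N ?T" "induced_norm n ?N ?T ^ (n - 1) \<le> 1"
    using induced_norm_nonneg[OF N T] induced_norm_shift_mat[OF l(2), of n]
      by (auto intro: power_le_one)
  ultimately have "s \<ge> 0" by (smt (verit) mult_nonpos_nonneg zero_le_power)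
  with le T1 show ?thesis using mult_left_le[of _ s] by (smt (verit))
qed

section \<open>Growth of the Schaeffer constant\<close>

theorem proposition2:
  fixes l :: complex
  assumes "l \<in> ball 0 1 - {0}"
  shows "\<exists>c > 0. \<forall>n \<ge> 1.
           schaeffer_const n \<ge> wiener_phi (replicate n l) \<and>
           wiener_phi (replicate n l) \<ge> c * sqrt (real n)"
proof -
  define c where "c = 1 / (2 * (3 + 2 * wave_const (cmod l)))"
  have l: "l \<noteq> 0" "cmod l < 1" using assms by auto
  have "c > 0" using wave_const_pos[of "cmod l"] l by (simp add: c_def)
  moreover have "schaeffer_const n \<ge> wiener_phi (replicate n l)" if "n \<ge> 1" for n
    unfolding schaeffer_const_def
    by (rule cInf_greatest) (use schaeffer_bound_exists wiener_phi_le_schaeffer_bound[OF l that]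
        in auto)
  moreover have "wiener_phi (replicate n l) \<ge> c * sqrt (real n)" if "n \<ge> 1" for n
    using wiener_phi_lower_bound[OF l that] by (simp add: c_def)
  ultimately show ?thesis by blast
qed

end
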